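(* Let $r\ge1$ be an integer. The number of unitary factors of finite abelian groups of order at most $x$ whose conjugates have rank at most $r$ is asymptotic, as $x\to\infty$, to $K_r\,x\log x$, where $K_r$ is a constant that depends on $r$. That is, there is a constant $K_r$ with $$\sum_G t(G)\sim K_r\,x\log x\qquad(x\to\infty),$$ where $G$ runs over isomorphism classes of finite abelian groups of order at most $x$ whose conjugate $G'$ has rank at most $r$, and $t(G)$ is the number of unitary factors of $G$.
   Context: Groups are considered up to isomorphism. A finite abelian group $G$ has unitary factors $H$ and $K$ if $G\cong H\oplus K$ and $H$ and $K$ have no common non-trivial direct factor (up to isomorphism). The number $t(G)$ of unitary factors of $G$ is the number of isomorphism classes of groups $H$ for which such a $K$ exists. The rank of a finite abelian group is its minimal number of generators. Conjugate group: for a prime $p$ and a finite abelian $p$-group $G\cong \mathbb Z/p^{a_1}\mathbb Z\oplus\cdots\oplus\mathbb Z/p^{a_r}\mathbb Z$ with $0\le a_1\le\cdots\le a_r$, the type of $G$ is the partition $\lambda=(a_1,\dots,a_r)$, and the conjugate $G'$ is the finite abelian $p$-group whose type is the conjugate (transposed) partition $\lambda'$. For a general finite abelian group, $G'$ is the direct sum of the conjugates of its $p$-primary components. *)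

theory Defs
  imports
    "HOL-Algebra.Product_Groups"
    "HOL-Computational_Algebra.Primes"
    "HOL-Library.Landau_Symbols"
begin

subsection \<open>Isomorphism classes of finite abelian groups\<close>

text \<open>
  Every finite group is isomorphic to one carried by a set of natural numbers, so groups on
  \<^typ>\<open>nat\<close> represent all isomorphism classes of finite abelian groups.
\<close>

definition fin_ab_groups :: "nat monoid set" where
  "fin_ab_groups = {G. comm_group G \<and> finite (carrier G)}"

definition iso_rel :: "(nat monoid \<times> nat monoid) set" where
  "iso_rel = {(G, H). G \<in> fin_ab_groups \<and> H \<in> fin_ab_groups \<and> G \<cong> H}"

lemma equiv_iso_rel: "equiv fin_ab_groups iso_rel"
proof (rule equivI)
  show "iso_rel \<subseteq> fin_ab_groups \<times> fin_ab_groups"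
    by (auto simp: iso_rel_def)
  show "refl_on fin_ab_groups iso_rel"
    by (auto simp: refl_on_def iso_rel_def iso_refl)
  show "sym iso_rel"
    by (auto simp: sym_def iso_rel_def fin_ab_groups_def comm_group_def intro: group.iso_sym)
  show "trans iso_rel"
    by (auto simp: trans_def iso_rel_def intro: iso_trans)
qed

definition iso_classes :: "nat monoid set set" where
  "iso_classes = fin_ab_groups // iso_rel"

definition rep :: "nat monoid set \<Rightarrow> nat monoid" where
  "rep C = (SOME G. G \<in> C)"

lemma rep_in_class: "C \<in> iso_classes \<Longrightarrow> rep C \<in> C"
  unfolding iso_classes_def rep_def
  using in_quotient_imp_non_empty[OF equiv_iso_rel] by (simp add: some_in_eq)


subsection \<open>Unitary factors\<close>

definition is_direct_factor :: "nat monoid \<Rightarrow> nat monoid \<Rightarrow> bool" where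
  "is_direct_factor D G \<longleftrightarrow>
     D \<in> fin_ab_groups \<and> (\<exists>L \<in> fin_ab_groups. G \<cong> D \<times>\<times> L)"

definition unitary_factors :: "nat monoid \<Rightarrow> nat monoid \<Rightarrow> nat monoid \<Rightarrow> bool" where
  "unitary_factors G H K \<longleftrightarrow>
     G \<cong> H \<times>\<times> K \<and>
     (\<forall>D. is_direct_factor D H \<and> is_direct_factor D K \<longrightarrow> carrier D = {\<one>\<^bsub>D\<^esub>})"

definition num_unitary_factors :: "nat monoid \<Rightarrow> nat" where
  "num_unitary_factors G =
     card {iso_rel `` {H} | H. H \<in> fin_ab_groups \<and> (\<exists>K \<in> fin_ab_groups. unitary_factors G H K)}"


subsection \<open>Rank\<close>

definition group_rank :: "('a, 'b) monoid_scheme \<Rightarrow> nat" where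
  "group_rank G =
     (LEAST n. \<exists>S \<subseteq> carrier G. finite S \<and> card S = n \<and> generate G S = carrier G)"


subsection \<open>Conjugate groups\<close>

text \<open>
  Partitions are nondecreasing lists. The type of a \<open>p\<close>-group is normalised to have no zero
  parts, which makes it unique; zero parts do not change the conjugate partition.
\<close>

definition abelian_p_group_of_type :: "nat \<Rightarrow> nat list \<Rightarrow> (nat \<Rightarrow> int) monoid" where
  "abelian_p_group_of_type p as =
     product_group {..<length as} (\<lambda>i. integer_mod_group (p ^ (as ! i)))"

definition p_group_type :: "nat \<Rightarrow> ('a, 'b) monoid_scheme \<Rightarrow> nat list" where
  "p_group_type p P =
     (THE as. sorted as \<and> 0 \<notin> set as \<and> P \<cong> abelian_p_group_of_type p as)"

text \<open>
  The conjugate of \<open>(a\<^sub>1, \<dots>, a\<^sub>r)\<close> has, for each \<open>j\<close> from \<open>1\<close> up to the largest part, the part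
  \<open>#{i. a\<^sub>i \<ge> j}\<close>.  These decrease in \<open>j\<close>, hence the reversal.
\<close>

definition conj_partition :: "nat list \<Rightarrow> nat list" where
  "conj_partition as =
     rev (map (\<lambda>j. length (filter (\<lambda>a. j \<le> a) as)) [1..<Suc (fold max as 0)])"

definition conj_p_group :: "nat \<Rightarrow> ('a, 'b) monoid_scheme \<Rightarrow> (nat \<Rightarrow> int) monoid" where
  "conj_p_group p P = abelian_p_group_of_type p (conj_partition (p_group_type p P))"

definition primary_component ::
  "nat \<Rightarrow> ('a, 'b) monoid_scheme \<Rightarrow> ('a, 'b) monoid_scheme" where
  "primary_component p G =
     G\<lparr>carrier := {x \<in> carrier G. \<exists>k::nat. x [^]\<^bsub>G\<^esub> (p ^ k) = \<one>\<^bsub>G\<^esub>}\<rparr>"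

text \<open>Only the primes dividing the order have a nontrivial primary component.\<close>

definition conj_group :: "('a, 'b) monoid_scheme \<Rightarrow> (nat \<Rightarrow> nat \<Rightarrow> int) monoid" where
  "conj_group G =
     product_group {p. prime p \<and> p dvd order G} (\<lambda>p. conj_p_group p (primary_component p G))"

end

(*
  The function m |-> #{x in G. x^m = 1} is multiplicative on direct products and equals gcd(m, q) on
  Z/q. Splitting off cyclic factors of maximal p-power order shows that it determines a finite abelian
  group up to isomorphism, so isomorphism classes correspond to finite multisets M of prime powers.
  In these terms the unitary factors of G are obtained by choosing some of the distinct members of M
  with their full multiplicity, so t(G) = 2^(number of distinct members); and since
  #{x in A. x^p = 1} <= p^rank(A), the conjugate of G has rank at most r iff every prime power in M
  has exponent at most r.

  Let F_r(x) be the resulting sum. Separating the members p^(r+1) of M gives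
  F_(r+1)(x) = sum_n 2^omega(n) F_r(x / n^(r+1)). For r = 1, F_1(x) = sum_(n <= x) 2^omega(n) counts
  coprime pairs (a, b) with a b <= x, hence F_1(x) = sum_g mu(g) D(x / g^2), where D is the summatory
  function of the number of divisors and D(x) ~ x log x. By dominated convergence for series,
  such weighted sums preserve asymptotics K x log x, and the constants stay positive.
*)
theory Submission
  imports
    "HOL-Analysis.Analysis"
    "HOL-Real_Asymp.Real_Asymp"
    "HOL-Number_Theory.Prime_Powers"
    "HOL-Algebra.Multiplicative_Group"
    "HOL-Library.Discrete_Functions"
    "HOL-Computational_Algebra.Squarefree"
    Defs
begin

subsection \<open>Complements of cyclic subgroups\<close>

text \<open>Working with counts avoids explicit isomorphisms, which matters most for the half of the
  rank criterion that bounds the rank from above. The conjugate is built prime by prime, but its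
  j-th cyclic factors at different primes have coprime orders, so together they are cyclic. If all
  exponents are at most r, the conjugate thus has the counts of a product of r cyclic groups, hence
  is isomorphic to it and has r generators.

  Asymptotics pass from r to r + 1 only from r = 1 on. The step from 0 to 1 has the weights
  2^omega(n) / n, whose series diverges, and this divergence is the source of the logarithm; hence
  the separate treatment of r = 1 by coprime pairs. Afterwards the weights are 2^omega(n) / n^k with
  k >= 2, and the crude bound 2^omega(n) <= 2 sqrt n makes their series converge.

  Positive constants are essential: asymptotic equivalence to the zero function would say that the
  sum vanishes eventually. For r = 1 the constant is a series with terms of both signs, so its sign
  needs a numerical estimate.\<close>

definition nsol :: "('a, 'b) monoid_scheme \<Rightarrow> nat \<Rightarrow> nat" where
  "nsol G m = card {x \<in> carrier G. x [^]\<^bsub>G\<^esub> m = \<one>\<^bsub>G\<^esub>}"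

text \<open>By Bezout, y is a power of y^i times a power of y^j.\<close>

lemma (in group) subgroup_int_pow_coprime:
  fixes i j :: int
  assumes L: "subgroup L G" and y: "y \<in> carrier G"
    and i: "y [^] i \<in> L" and j: "y [^] j \<in> L" and ij: "coprime i j"
  shows "y \<in> L"
proof -
  obtain a b where ab: "a * i + b * j = 1"
    using ij by (metis bezout_int coprime_imp_gcd_eq_1)
  have "y = y [^] (i * a + j * b)"
    using ab y by (simp add: mult.commute)
  also have "\<dots> = (y [^] i) [^] a \<otimes> (y [^] j) [^] b"
    using y by (simp add: int_pow_mult int_pow_pow)
  also have "\<dots> \<in> L"
    using i j L by (simp add: subgroup.m_closed subgroup_int_pow_closed)
  finally show ?thesis .
qed

text \<open>Let N be the least positive exponent with y^N in \<open>L\<close>. It is not 1, so it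
  has a prime divisor q, and the exponent N / q works.\<close>

lemma (in group) prime_power_into_subgroup:
  assumes L: "subgroup L G" and y: "y \<in> carrier G" "y \<notin> L" and fin: "finite (carrier G)"
  obtains q :: nat and n :: nat where "prime q" "y [^] n \<notin> L" "(y [^] n) [^] q \<in> L"
proof -
  define n where "n = (LEAST n::nat. n > 0 \<and> y [^] n \<in> L)"
  have "\<exists>n::nat. n > 0 \<and> y [^] n \<in> L"
    using L y(1) fin by (metis ord_ge_1 pow_ord_eq_1 subgroup.one_closed less_le_trans zero_less_one)
  then have n: "n > 0" "y [^] n \<in> L"
    unfolding n_def by (metis (mono_tags, lifting) LeastI_ex)+
  have nmin: "m \<ge> n" if "m > 0" "y [^] m \<in> L" for m
    unfolding n_def using that by (simp add: Least_le)
  have "n \<noteq> 1" using n y by auto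
  then obtain q where q: "prime q" "q dvd n" using prime_factor_nat by blast
  then obtain m where m: "n = q * m" by blast
  have m0: "m > 0" "m < n" using m n q(1) prime_gt_1_nat[OF q(1)] by auto
  show thesis
  proof (rule that[of q m])
    show "y [^] m \<notin> L" using nmin[of m] m0 by auto
    show "(y [^] m) [^] q \<in> L" using n(2) m y by (simp add: nat_pow_pow mult.commute)
  qed (rule q(1))
qed

lemma (in comm_group) mem_cyclic_set_mult:
  assumes "x \<in> carrier G" "K \<subseteq> carrier G"
  shows "g \<in> generate G {x} <#> K \<longleftrightarrow> (\<exists>(a::int). \<exists>k\<in>K. g = x [^] a \<otimes> k)"
  using assms unfolding set_mult_def generate_pow[OF assms(1)] by auto

text \<open>A maximal subgroup meeting the cyclic group of maximal \<open>p\<close>-power order trivially is a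
  complement of it.\<close>

lemma (in comm_group) complement_exists:
  assumes fin: "finite (carrier G)" and p: "prime (p::nat)" and x: "x \<in> carrier G"
    and ordx: "ord x = p ^ k"
    and xmax: "\<And>y j. y \<in> carrier G \<Longrightarrow> y [^] (p ^ j) = \<one> \<Longrightarrow> y [^] (p ^ k) = \<one>"
  obtains K where "subgroup K G" "generate G {x} \<inter> K = {\<one>}" "generate G {x} <#> K = carrier G"
proof -
  define S where "S = {K. subgroup K G \<and> generate G {x} \<inter> K = {\<one>}}"
  have "finite S"
    by (rule finite_subset[of _ "Pow (carrier G)"]) (auto simp: S_def fin dest: subgroup.subset)
  moreover have "{\<one>} \<in> S"
    using x by (auto simp: S_def triv_subgroup generate.one)
  ultimately obtain K where KS: "K \<in> S" and Kmax: "\<And>K'. K' \<in> S \<Longrightarrow> K \<subseteq> K' \<Longrightarrow> K' = K"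
    by (metis finite_has_maximal2)
  have K: "subgroup K G" and Kx: "generate G {x} \<inter> K = {\<one>}" using KS by (auto simp: S_def)
  have Ksub: "K \<subseteq> carrier G" using K by (rule subgroup.subset)
  note Kcl [simp] = subsetD[OF Ksub]
  define L where "L = generate G {x} <#> K"
  have gx: "subgroup (generate G {x}) G" using x by (simp add: generate_is_subgroup)
  have L: "subgroup L G" unfolding L_def using gx K by (rule mult_subgroups)
  have memL: "g \<in> L \<longleftrightarrow> (\<exists>(a::int). \<exists>k\<in>K. g = x [^] a \<otimes> k)" for g
    unfolding L_def using x Ksub by (rule mem_cyclic_set_mult)
  have xL: "x [^] (a::int) \<in> L" for a
    unfolding memL using x K by (auto intro!: exI[of _ a] bexI[of _ \<one>] simp: subgroup.one_closed)
  have KL: "k \<in> K \<Longrightarrow> k \<in> L" for k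
    unfolding memL by (auto intro!: exI[of _ 0] bexI[of _ k])
  have Kxa: "x [^] (a::int) = \<one>" if "x [^] a \<in> K" for a
  proof -
    have "x [^] a \<in> generate G {x}" unfolding generate_pow[OF x] by blast
    with Kx that show ?thesis by blast
  qed
  \<comment> \<open>A prime power of an element outside \<open>L\<close> can be moved from \<open>L\<close> into \<open>K\<close>.\<close>
  have step: "\<exists>y q. y \<in> carrier G \<and> y \<notin> L \<and> prime q \<and> y [^] int q \<in> K"
    if ne: "L \<noteq> carrier G"
  proof -
    obtain y0 where y0: "y0 \<in> carrier G" "y0 \<notin> L"
      using ne subgroup.subset[OF L] by blast
    obtain q n :: nat where q: "prime q" and qn: "y0 [^] n \<notin> L" "(y0 [^] n) [^] q \<in> L"
      by (rule prime_power_into_subgroup[OF L y0 fin])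
    define y where "y = y0 [^] n"
    have y: "y \<in> carrier G" "y \<notin> L" "y [^] q \<in> L"
      using y0 qn by (auto simp: y_def)
    \<comment> \<open>If z^q lies in \<open>K\<close> up to the q-th power of x^c, dividing z by x^c
      removes that factor. As x^c belongs to \<open>L\<close>, the quotient stays outside
      \<open>L\<close>.\<close>
    have shift: ?thesis if "z \<in> carrier G" "z \<notin> L" "z [^] int q = (x [^] (c::int)) [^] int q \<otimes> h" "h \<in> K" for z c h
    proof (intro exI conjI)
      let ?w = "z \<otimes> inv (x [^] c)"
      show "?w \<in> carrier G" using that x by simp
      show "?w \<notin> L"
      proof
        assume "?w \<in> L"
        then have "?w \<otimes> x [^] c \<in> L" using L xL by (simp add: subgroup.m_closed)
        then show False using that x by (simp add: m_assoc)
      qed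
      have "?w [^] int q = z [^] int q \<otimes> inv ((x [^] c) [^] int q)"
        using that(1) x by (simp add: int_pow_distrib int_pow_inv)
      also have "\<dots> = h" using that x by (simp add: m_ac)
      finally show "?w [^] int q \<in> K" using that by simp
    qed (rule q)
    show ?thesis
    proof (cases "q = p")
      case False
      obtain a h where ah: "y [^] int q = x [^] (a::int) \<otimes> h" "h \<in> K"
        using y(3) memL by (auto simp: int_pow_int)
      have "coprime (int q) (int p ^ k)" using False q p
        by (simp add: primes_coprime)
      \<comment> \<open>q is invertible modulo the order p^k of x, so x^a is the q-th power of x^(a
        u).\<close>
      then obtain u v where uv: "u * int q + v * int p ^ k = 1"
        by (metis bezout_int coprime_imp_gcd_eq_1)
      have "x [^] a = (x [^] (a * u)) [^] int q"
      proof -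
        have "a * u * int q - a = a * (u * int q + v * int p ^ k) - a - a * v * int p ^ k"
          by (simp add: algebra_simps)
        then have "a * u * int q - a = int p ^ k * (- a * v)" using uv by (simp add: algebra_simps)
        then have "int (ord x) dvd a * u * int q - a" by (simp add: ordx)
        then show ?thesis using x by (simp add: int_pow_pow int_pow_eq)
      qed
      with shift[OF y(1,2) _ ah(2), of "a * u"] ah(1) show ?thesis by simp
    next
      case True
      \<comment> \<open>\<open>m'\<close> is the part of the group order prime to p. Raising y to it
        gives an element z of p-power order, so that \<open>xmax\<close> applies, and z stays
        outside \<open>L\<close> because \<open>m'\<close> and p are coprime.\<close>
      define N where "N = order G"
      have N0: "N \<noteq> 0" using fin by (simp add: N_def order_gt_0_iff_finite)
      obtain m' where m': "N = p ^ multiplicity p N * m'" "\<not> p dvd m'"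
        using N0 p by (metis multiplicity_decompose' not_prime_unit)
      define z where "z = y [^] int m'"
      have z: "z \<in> carrier G" using y by (simp add: z_def)
      have zL: "z \<notin> L"
      proof
        assume "z \<in> L"
        moreover have "coprime (int m') (int p)" using m'(2) p
          by (metis coprime_commute coprime_int_iff prime_imp_coprime)
        ultimately have "y \<in> L"
          using subgroup_int_pow_coprime[OF L y(1), of "int m'" "int p"] y(3) True
          by (simp add: z_def int_pow_int)
        with y show False by simp
      qed
      have "z [^] (p ^ multiplicity p N) = \<one>"
        using y m'(1) pow_order_eq_1[of y]
        by (simp add: z_def int_pow_int nat_pow_pow N_def[symmetric] mult.commute)
      then have zk: "z [^] (p ^ k) = \<one>" using xmax z by blast
      have "z [^] int p \<in> L"
      proof -
        have "z [^] int p = (y [^] q) [^] int m'"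
          using y True by (simp add: z_def int_pow_int nat_pow_pow mult.commute)
        then show ?thesis using y(3) L by (simp add: subgroup_int_pow_closed)
      qed
      then obtain a h where ah: "z [^] int p = x [^] (a::int) \<otimes> h" "h \<in> K"
        using memL by auto
      \<comment> \<open>Raising z^p = x^a h to the power p^(k-1) gives 1 on the left, so x^(a
        p^(k-1)) lies in \<open>K\<close> and equals 1. As x has order p^k, p divides a. For k = 0,
        z itself would be 1.\<close>
      have "\<exists>c. a = c * int p"
      proof (cases k)
        case 0
        then have "z = \<one>" using zk z by simp
        then show ?thesis using zL L by (simp add: subgroup.one_closed)
      next
        case (Suc k')
        have "\<one> = (z [^] int p) [^] (int p ^ k')"
          using zk z Suc by (simp add: int_pow_pow flip: int_pow_int)
        also have "\<dots> = x [^] (a * int p ^ k') \<otimes> h [^] (int p ^ k')"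
          using ah x by (simp add: int_pow_distrib int_pow_pow)
        finally have "x [^] (a * int p ^ k') = inv (h [^] (int p ^ k'))"
          using ah x by (metis Kcl int_pow_closed inv_equality)
        also have "\<dots> \<in> K" using ah K by (simp add: subgroup.m_inv_closed subgroup_int_pow_closed)
        finally have "x [^] (a * int p ^ k') = \<one>" by (rule Kxa)
        then have "int p ^ k dvd a * int p ^ k'" using x by (simp add: int_pow_eq_id ordx)
        then have "int p dvd a" using Suc p by (auto simp: prime_gt_0_nat mult.commute)
        then show ?thesis by (metis dvd_div_mult_self)
      qed
      then obtain c where c: "a = c * int p" by blast
      show ?thesis
        using shift[OF z zL _ ah(2), of c] ah(1) c True x by (simp add: int_pow_pow)
    qed
  qed
  have "L = carrier G"
  proof (rule ccontr)
    assume "L \<noteq> carrier G"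
    then obtain y q where y: "y \<in> carrier G" "y \<notin> L" and q: "prime (q::nat)" and yq: "y [^] int q \<in> K"
      using step by blast
    \<comment> \<open>By maximality of \<open>K\<close>, the larger \<open>K'\<close> contains some
      g = y^i h other than 1 that is a power of x. If q divides i, then g lies in \<open>K\<close>,
      which is excluded; otherwise y^i and y^q lie in \<open>L\<close> with coprime exponents, and
      so does y.\<close>
    define K' where "K' = generate G {y} <#> K"
    have K': "subgroup K' G" unfolding K'_def using y K by (simp add: generate_is_subgroup mult_subgroups)
    have memK': "g \<in> K' \<longleftrightarrow> (\<exists>(a::int). \<exists>k\<in>K. g = y [^] a \<otimes> k)" for g
      unfolding K'_def using y(1) Ksub by (rule mem_cyclic_set_mult)
    have "K \<subseteq> K'"
      by (auto simp: memK' intro!: exI[of _ 0])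
    moreover have "y \<in> K'" using y K
      by (auto simp: memK' subgroup.one_closed intro!: exI[of _ 1] bexI[of _ \<one>])
    moreover have "y \<notin> K" using y KL by blast
    ultimately have "K' \<notin> S" using Kmax by blast
    then have "generate G {x} \<inter> K' \<noteq> {\<one>}" using K' by (simp add: S_def)
    moreover have "\<one> \<in> generate G {x} \<inter> K'" using K' by (simp add: generate.one subgroup.one_closed)
    ultimately obtain g where g: "g \<in> generate G {x}" "g \<in> K'" "g \<noteq> \<one>" by blast
    then obtain b i h where gb: "g = x [^] (b::int)" and gi: "g = y [^] (i::int) \<otimes> h" and h: "h \<in> K"
      using x unfolding memK' generate_pow[OF x] by blast
    have yi: "y [^] i = x [^] b \<otimes> inv h"
      using gb gi h y x by (metis Kcl int_pow_closed inv_solve_right)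
    show False
    proof (cases "int q dvd i")
      case True
      then obtain j where "i = int q * j" by blast
      then have "y [^] i \<in> K" using y yq K by (simp add: subgroup_int_pow_closed flip: int_pow_pow)
      then have "g \<in> K" using gi h K by (simp add: subgroup.m_closed)
      then show False using g Kx by blast
    next
      case False
      then have "coprime (int q) i" using q by (simp add: prime_imp_coprime)
      moreover have "y [^] i \<in> L" unfolding yi memL using subgroup.m_inv_closed[OF K h] by blast
      moreover have "y [^] int q \<in> L" using yq KL by blast
      ultimately show False using subgroup_int_pow_coprime[OF L y(1)] y by blast
    qed
  qed
  then show thesis using that K Kx by (simp add: L_def)
qed

subsection \<open>Groups with equally many solutions of \<open>x^m = 1\<close>\<close>

text \<open>The isomorphism sends (a, h) to x^a h; it is injective because the complement meets the
  powers of x only in 1.\<close>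

lemma (in comm_group) split_off_cyclic:
  assumes fin: "finite (carrier G)" and p: "prime (p::nat)" and x: "x \<in> carrier G"
    and ordx: "ord x = p ^ k"
    and kmax: "\<And>y j. y \<in> carrier G \<Longrightarrow> ord y = p ^ j \<Longrightarrow> j \<le> k"
  obtains K where "subgroup K G" "integer_mod_group (p ^ k) \<times>\<times> G\<lparr>carrier := K\<rparr> \<cong> G"
proof -
  have "y [^] (p ^ k) = \<one>" if "y \<in> carrier G" "y [^] (p ^ j) = \<one>" for y j
  proof -
    have "ord y dvd p ^ j" using that by (simp add: pow_eq_id)
    then obtain i where "ord y = p ^ i"
      using p by (auto simp: divides_primepow_nat)
    then show ?thesis using kmax[of y i] that(1) by (simp add: pow_eq_id le_imp_power_dvd)
  qed
  then obtain K where K: "subgroup K G" "generate G {x} \<inter> K = {\<one>}" "generate G {x} <#> K = carrier G"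
    using complement_exists[OF fin p x ordx] by metis
  define f where "f = (\<lambda>(a::int, h). x [^] a \<otimes> h)"
  have Ksub: "K \<subseteq> carrier G" using K(1) by (rule subgroup.subset)
  note Kcl [simp] = subsetD[OF Ksub]
  have pk: "p ^ k \<noteq> 0" using p by (simp add: prime_gt_0_nat)
  \<comment> \<open>\<open>integer_mod_group\<close> computes with residues in {0..<p^k}, so
    exponents of x must be reducible modulo its order.\<close>
  have xmod: "x [^] (a mod int (p ^ k)) = x [^] a" for a :: int
  proof -
    have "int (p ^ k) dvd a - a mod int (p ^ k)" by (rule dvd_minus_mod)
    then show ?thesis using x int_pow_eq[OF x, of "a mod int (p ^ k)" a] by (simp add: ordx)
  qed
  have car: "carrier (integer_mod_group (p ^ k)) = {0..<int (p ^ k)}"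
    by (simp only: carrier_integer_mod_group pk if_False)
  have "f \<in> iso (integer_mod_group (p ^ k) \<times>\<times> G\<lparr>carrier := K\<rparr>) G"
  proof (rule isoI)
    show "f \<in> hom (integer_mod_group (p ^ k) \<times>\<times> G\<lparr>carrier := K\<rparr>) G"
      using x by (auto simp: hom_def f_def mult_DirProd' int_pow_mult m_ac xmod[simplified])
    show "bij_betw f (carrier (integer_mod_group (p ^ k) \<times>\<times> G\<lparr>carrier := K\<rparr>)) (carrier G)"
      unfolding bij_betw_def
    proof
      show "inj_on f (carrier (integer_mod_group (p ^ k) \<times>\<times> G\<lparr>carrier := K\<rparr>))"
      proof (rule inj_onI, clarsimp simp: car f_def simp del: of_nat_power)
        fix a b h h'
        assume h: "h \<in> K" "h' \<in> K" and ab: "0 \<le> a" "a < int (p ^ k)" "0 \<le> b" "b < int (p ^ k)"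
          and eq: "x [^] a \<otimes> h = x [^] b \<otimes> h'"
        have "x [^] a = x [^] b \<otimes> h' \<otimes> inv h"
          using eq h x by (subst inv_solve_right) simp_all
        then have "x [^] (a - b) = h' \<otimes> inv h"
          using h x int_pow_diff[OF x, of a b] by (simp add: m_ac)
        also have "\<dots> \<in> K" using h K(1) by (simp add: subgroup.m_closed subgroup.m_inv_closed)
        finally have mK: "x [^] (a - b) \<in> K" .
        have "x [^] (a - b) \<in> generate G {x}" unfolding generate_pow[OF x] by blast
        with mK K(2) have "x [^] (a - b) = \<one>" by blast
        then have "int (p ^ k) dvd a - b" using x by (simp add: int_pow_eq_id ordx)
        then have "a = b" using ab by (metis mod_eq_dvd_iff mod_pos_pos_trivial)
        with eq h x show "a = b \<and> h = h'" by simp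
      qed
      show "f ` carrier (integer_mod_group (p ^ k) \<times>\<times> G\<lparr>carrier := K\<rparr>) = carrier G"
      proof
        show "f ` carrier (integer_mod_group (p ^ k) \<times>\<times> G\<lparr>carrier := K\<rparr>) \<subseteq> carrier G"
          using x by (auto simp: f_def)
        show "carrier G \<subseteq> f ` carrier (integer_mod_group (p ^ k) \<times>\<times> G\<lparr>carrier := K\<rparr>)"
        proof
          fix g assume "g \<in> carrier G"
          then obtain a h where ah: "h \<in> K" "g = x [^] (a::int) \<otimes> h"
            using K(3) mem_cyclic_set_mult[OF x Ksub] by blast
          have "g = f (a mod int (p ^ k), h)" unfolding f_def using ah xmod[of a] by simp
          moreover have "(a mod int (p ^ k), h) \<in> carrier (integer_mod_group (p ^ k) \<times>\<times> G\<lparr>carrier := K\<rparr>)"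
            using ah pk p by (simp add: car prime_gt_0_nat)
          ultimately show "g \<in> f ` carrier (integer_mod_group (p ^ k) \<times>\<times> G\<lparr>carrier := K\<rparr>)" by blast
        qed
      qed
    qed
  qed
  then show thesis using that K(1) by (auto simp: is_iso_def)
qed

lemma (in comm_group) comm_group_subgroup:
  assumes "subgroup K G"
  shows "comm_group (G\<lparr>carrier := K\<rparr>)"
proof (rule group.group_comm_groupI)
  show "group (G\<lparr>carrier := K\<rparr>)" using assms by (rule subgroup_imp_group)
qed (use subgroup.subset[OF assms] in \<open>auto intro: m_comm\<close>)

section \<open>Counts under isomorphisms, in products and in cyclic groups\<close>

lemma nsol_iso:
  assumes "G \<cong> H" "group G" "group H"
  shows "nsol G m = nsol H m"
proof -
  obtain f where f: "f \<in> iso G H" using assms by (auto simp: is_iso_def)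
  interpret f: group_hom G H f
    using assms f by (simp add: group_hom_def group_hom_axioms_def iso_def)
  have b: "bij_betw f (carrier G) (carrier H)" using f by (simp add: iso_def)
  have "f ` {x \<in> carrier G. x [^]\<^bsub>G\<^esub> m = \<one>\<^bsub>G\<^esub>} = {x \<in> carrier H. x [^]\<^bsub>H\<^esub> m = \<one>\<^bsub>H\<^esub>}"
  proof (intro equalityI subsetI)
    fix y assume "y \<in> f ` {x \<in> carrier G. x [^]\<^bsub>G\<^esub> m = \<one>\<^bsub>G\<^esub>}"
    then show "y \<in> {x \<in> carrier H. x [^]\<^bsub>H\<^esub> m = \<one>\<^bsub>H\<^esub>}"
      by (auto simp flip: f.hom_nat_pow)
  next
    fix y assume y: "y \<in> {x \<in> carrier H. x [^]\<^bsub>H\<^esub> m = \<one>\<^bsub>H\<^esub>}"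
    then obtain x where x: "x \<in> carrier G" "y = f x" using b by (auto simp: bij_betw_def)
    then have "f (x [^]\<^bsub>G\<^esub> m) = f \<one>\<^bsub>G\<^esub>" using y by (simp add: f.hom_nat_pow)
    then have "x [^]\<^bsub>G\<^esub> m = \<one>\<^bsub>G\<^esub>"
      by (rule inj_onD[OF bij_betw_imp_inj_on[OF b]]) (use x in auto)
    with x show "y \<in> f ` {x \<in> carrier G. x [^]\<^bsub>G\<^esub> m = \<one>\<^bsub>G\<^esub>}" by blast
  qed
  then have "bij_betw f {x \<in> carrier G. x [^]\<^bsub>G\<^esub> m = \<one>\<^bsub>G\<^esub>} {x \<in> carrier H. x [^]\<^bsub>H\<^esub> m = \<one>\<^bsub>H\<^esub>}"
    using b by (auto simp: bij_betw_def intro: inj_on_subset)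
  then show ?thesis unfolding nsol_def by (rule bij_betw_same_card)
qed

lemma nsol_DirProd:
  assumes "group G" "group H"
  shows "nsol (G \<times>\<times> H) m = nsol G m * nsol H m"
proof -
  have pow: "(x, y) [^]\<^bsub>G \<times>\<times> H\<^esub> m = (x [^]\<^bsub>G\<^esub> m, y [^]\<^bsub>H\<^esub> m)" for x y
    by (induction m) (simp_all add: nat_pow_def)
  have "{x \<in> carrier (G \<times>\<times> H). x [^]\<^bsub>G \<times>\<times> H\<^esub> m = \<one>\<^bsub>G \<times>\<times> H\<^esub>}
      = {x \<in> carrier G. x [^]\<^bsub>G\<^esub> m = \<one>\<^bsub>G\<^esub>} \<times> {x \<in> carrier H. x [^]\<^bsub>H\<^esub> m = \<one>\<^bsub>H\<^esub>}"
    by (auto simp: pow)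
  then show ?thesis by (simp add: nsol_def card_cartesian_product)
qed

text \<open>With g = gcd m n, n divides m x exactly when n / g divides x, because m / g and n / g
  are coprime. This leaves the g multiples of n / g below n.\<close>

lemma nsol_integer_mod_group:
  assumes "n > 0"
  shows "nsol (integer_mod_group n) m = gcd m n"
proof -
  define g where "g = gcd m n"
  obtain m' n' where "m = m' * g" "n = n' * g" and cop: "coprime m' n'"
    using gcd_coprime_exists[of m n] assms unfolding g_def by auto
  then have n': "n = g * n'" and m': "m = g * m'" by simp_all
  have g0: "g > 0" "n' > 0" using assms n' by auto
  have "{x \<in> carrier (integer_mod_group n). x [^]\<^bsub>integer_mod_group n\<^esub> m = \<one>\<^bsub>integer_mod_group n\<^esub>}
      = {x. 0 \<le> x \<and> x < int n \<and> int n dvd int m * x}"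
    using assms by (auto simp: carrier_integer_mod_group)
  also have "\<dots> = (\<lambda>i. int (n' * i)) ` {..<g}"
  proof (intro equalityI subsetI)
    fix x assume "x \<in> {x. 0 \<le> x \<and> x < int n \<and> int n dvd int m * x}"
    then have x: "0 \<le> x" "x < int n" "int n dvd int m * x" by auto
    then have "int n' dvd int m' * x" using g0 by (simp add: n' m' mult.assoc)
    then have "int n' dvd x" using cop by (simp add: coprime_dvd_mult_right_iff coprime_commute)
    then obtain i where i: "x = int n' * i" by blast
    have "0 \<le> i" using x i g0 by (simp add: zero_le_mult_iff)
    moreover have "i < int g" using x i g0 n' by (simp add: mult.commute)
    ultimately show "x \<in> (\<lambda>i. int (n' * i)) ` {..<g}"
      using i by (intro image_eqI[of _ _ "nat i"]) auto
  next
    fix x assume "x \<in> (\<lambda>i. int (n' * i)) ` {..<g}"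
    then obtain i where i: "i < g" "x = int (n' * i)" by blast
    have "int n dvd int m * x" unfolding i n' m' by (auto simp: mult_ac)
    moreover have "n' * i < n" using i g0 by (simp add: n' mult.commute)
    then have "x < int n" unfolding i(2) by (rule of_nat_less_iff[THEN iffD2])
    ultimately show "x \<in> {x. 0 \<le> x \<and> x < int n \<and> int n dvd int m * x}" using i by simp
  qed
  finally show ?thesis
    unfolding nsol_def using g0 by (simp add: card_image inj_on_def g_def)
qed

lemma nsol_product_group:
  assumes "finite I" "\<And>i. i \<in> I \<Longrightarrow> group (G i)"
  shows "nsol (product_group I G) m = (\<Prod>i\<in>I. nsol (G i) m)"
proof -
  have pow: "x [^]\<^bsub>product_group I G\<^esub> m = (\<lambda>i\<in>I. x i [^]\<^bsub>G i\<^esub> m)" for x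
    by (induction m) (auto simp: nat_pow_def fun_eq_iff)
  have r: "restrict f I = restrict g I \<longleftrightarrow> (\<forall>i\<in>I. f i = g i)" for f g :: "_ \<Rightarrow> 'b"
    by (metis restrict_apply' restrict_ext)
  have "{x \<in> carrier (product_group I G). x [^]\<^bsub>product_group I G\<^esub> m = \<one>\<^bsub>product_group I G\<^esub>}
      = (\<Pi>\<^sub>E i\<in>I. {x \<in> carrier (G i). x [^]\<^bsub>G i\<^esub> m = \<one>\<^bsub>G i\<^esub>})"
  proof (rule Set.set_eqI)
    fix x
    have "x \<in> {x \<in> carrier (product_group I G). x [^]\<^bsub>product_group I G\<^esub> m = \<one>\<^bsub>product_group I G\<^esub>}
      \<longleftrightarrow> x \<in> (\<Pi>\<^sub>E i\<in>I. carrier (G i)) \<and> (\<forall>i\<in>I. x i [^]\<^bsub>G i\<^esub> m = \<one>\<^bsub>G i\<^esub>)"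
      unfolding one_product_group carrier_product_group pow mem_Collect_eq r ..
    then show "x \<in> {x \<in> carrier (product_group I G). x [^]\<^bsub>product_group I G\<^esub> m = \<one>\<^bsub>product_group I G\<^esub>}
      \<longleftrightarrow> x \<in> (\<Pi>\<^sub>E i\<in>I. {x \<in> carrier (G i). x [^]\<^bsub>G i\<^esub> m = \<one>\<^bsub>G i\<^esub>})"
      by (simp only: PiE_iff mem_Collect_eq) blast
  qed
  then show ?thesis using assms(1) by (simp add: nsol_def card_PiE)
qed

lemma nsol_0: "nsol G 0 = order G"
  by (simp add: nsol_def order_def)

text \<open>Elements of order p^(j+1) are the solutions for p^(j+1) that are not solutions for p^j.
  Hence groups with equal counts have the same p-power orders of elements.\<close>

lemma (in group) ord_prime_power_iff_nsol:
  assumes "finite (carrier G)" "prime (p::nat)"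
  shows "(\<exists>x\<in>carrier G. ord x = p ^ Suc j) \<longleftrightarrow> nsol G (p ^ j) < nsol G (p ^ Suc j)"
proof -
  let ?A = "\<lambda>j. {x \<in> carrier G. x [^] (p ^ j) = \<one>}"
  have sub: "?A j \<subseteq> ?A (Suc j)"
    using pow_eq_id by (auto intro: dvd_trans)
  have "ord x = p ^ Suc j \<longleftrightarrow> x \<in> ?A (Suc j) - ?A j" if "x \<in> carrier G" for x
  proof
    assume "ord x = p ^ Suc j"
    then show "x \<in> ?A (Suc j) - ?A j"
      using that assms(2) prime_gt_1_nat[OF assms(2)] by (auto simp: pow_eq_id simp del: power_Suc dest: power_dvd_imp_le)
  next
    assume "x \<in> ?A (Suc j) - ?A j"
    then have "ord x dvd p ^ Suc j" "\<not> ord x dvd p ^ j" using that by (auto simp: pow_eq_id)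
    then obtain i where "ord x = p ^ i" "i \<le> Suc j" "\<not> i \<le> j"
      using assms(2) by (metis divides_primepow_nat le_imp_power_dvd)
    then show "ord x = p ^ Suc j" by (simp add: le_Suc_eq)
  qed
  then have "(\<exists>x\<in>carrier G. ord x = p ^ Suc j) \<longleftrightarrow> ?A j \<subset> ?A (Suc j)"
    using sub by blast
  also have "\<dots> \<longleftrightarrow> card (?A j) < card (?A (Suc j))"
  proof
    assume "?A j \<subset> ?A (Suc j)"
    then show "card (?A j) < card (?A (Suc j))" using assms(1) by (intro psubset_card_mono) auto
  next
    assume "card (?A j) < card (?A (Suc j))"
    then have "?A j \<noteq> ?A (Suc j)" by (rule contrapos_pn) simp
    with sub show "?A j \<subset> ?A (Suc j)" by blast
  qed
  finally show ?thesis by (simp add: nsol_def)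
qed

section \<open>The counts determine the group\<close>

lemma iso_trivial_groups:
  assumes "group G" "group H" "order G = 1" "order H = 1"
  shows "G \<cong> H"
proof -
  have "carrier G = {\<one>\<^bsub>G\<^esub>}" "carrier H = {\<one>\<^bsub>H\<^esub>}"
    using assms by (metis card_1_singletonE monoid.one_closed group.is_monoid order_def singletonD)+
  then have "(\<lambda>_. \<one>\<^bsub>H\<^esub>) \<in> iso G H"
    using assms by (auto simp: iso_def hom_def bij_betw_def group.is_monoid)
  then show ?thesis by (auto simp: is_iso_def)
qed

lemma (in group) exists_ord_prime:
  assumes "finite (carrier G)" "order G \<noteq> 1"
  obtains p x where "prime (p::nat)" "x \<in> carrier G" "ord x = p"
proof -
  obtain y where y: "y \<in> carrier G" "y \<noteq> \<one>"
  proof -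
    have "carrier G \<noteq> {\<one>}" using assms(2) by (auto simp: order_def)
    then show ?thesis using that one_closed by blast
  qed
  then have "ord y \<noteq> 1" using ord_eq_1 by blast
  then obtain p where p: "prime p" "p dvd ord y" using prime_factor_nat by blast
  have "ord (y [^] (ord y div p)) = p"
  proof -
    obtain c where c: "ord y = c * p" using p(2) by (metis dvdE mult.commute)
    have "ord y \<ge> 1" using assms(1) y(1) by (rule ord_ge_1)
    then have "c \<noteq> 0" "p \<noteq> 0" using c by auto
    then show ?thesis using ord_pow[OF y(1), of c] c by simp
  qed
  with p(1) y(1) show thesis by (intro that[of p "y [^] (ord y div p)"]) simp_all
qed

text \<open>Exponents are bounded because j < p^j <= order G. Since p itself occurs as an order, the
  maximum is positive; the form \<open>Suc k\<close> records that the cyclic factor split off later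
  is nontrivial.\<close>

lemma (in comm_group) exists_maximal_prime_power_order:
  assumes "finite (carrier G)" "x \<in> carrier G" "ord x = p" "prime (p::nat)"
  obtains k where "\<exists>x\<in>carrier G. ord x = p ^ Suc k"
    "\<And>y j. y \<in> carrier G \<Longrightarrow> ord y = p ^ j \<Longrightarrow> j \<le> Suc k"
proof -
  define J where "J = {j. \<exists>y\<in>carrier G. ord y = p ^ j}"
  have "j \<le> order G" if "j \<in> J" for j
  proof -
    obtain y where y: "y \<in> carrier G" "ord y = p ^ j" using \<open>j \<in> J\<close> by (auto simp: J_def)
    have "j < p ^ j" using prime_gt_Suc_0_nat[OF assms(4)] by (rule power_gt_expt)
    also have "p ^ j \<le> order G"
      using y assms(1) by (metis ord_dvd_group_order dvd_imp_le order_gt_0_iff_finite)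
    finally show ?thesis by simp
  qed
  then have J: "finite J" by (metis finite_nat_set_iff_bounded_le)
  have "1 \<in> J" using assms by (auto simp: J_def)
  then have "Max J \<ge> 1" "Max J \<in> J" using J by (auto intro: Max_in)
  then obtain k where "Max J = Suc k" "Suc k \<in> J" by (cases "Max J") auto
  then have k: "\<exists>x\<in>carrier G. ord x = p ^ Suc k" by (simp add: J_def)
  have "j \<le> Suc k" if "y \<in> carrier G" "ord y = p ^ j" for y j
  proof -
    have "j \<in> J" using that unfolding J_def by blast
    then show ?thesis using Max_ge[OF J, of j] \<open>Max J = Suc k\<close> by simp
  qed
  with k show thesis by (rule that)
qed

text \<open>The prime and its maximal power are found in G, and the counts force the same maximum in
  H. Both groups then split off the same cyclic factor. Its count gcd(m, p^(k+1)) is positive even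
  for m = 0, so it cancels, and the complements have equal counts and smaller order.\<close>

theorem iso_if_nsol_eq:
  assumes "comm_group G" "finite (carrier G)" "comm_group H" "finite (carrier H)"
    and "\<And>m. nsol G m = nsol H m"
  shows "G \<cong> H"
  using assms
proof (induction "order G" arbitrary: G H rule: less_induct)
  case (less G H)
  interpret G: comm_group G by fact
  interpret H: comm_group H by fact
  have ord: "order G = order H" using less.prems(5)[of 0] by (simp add: nsol_0)
  show ?case
  proof (cases "order G = 1")
    case True
    then show ?thesis using ord G.is_group H.is_group iso_trivial_groups by metis
  next
    case False
    obtain p x0 where p: "prime (p::nat)" and x0: "x0 \<in> carrier G" "G.ord x0 = p"
      using G.exists_ord_prime[OF less.prems(2) False] by blast
    obtain k where k: "\<exists>x\<in>carrier G. G.ord x = p ^ Suc k"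
      and kmax: "\<And>y j. y \<in> carrier G \<Longrightarrow> G.ord y = p ^ j \<Longrightarrow> j \<le> Suc k"
      using G.exists_maximal_prime_power_order[OF less.prems(2) x0 p] by blast
    have tr: "(\<exists>x\<in>carrier G. G.ord x = p ^ Suc j) \<longleftrightarrow> (\<exists>x\<in>carrier H. H.ord x = p ^ Suc j)" for j
      using G.ord_prime_power_iff_nsol[OF less.prems(2) p] H.ord_prime_power_iff_nsol[OF less.prems(4) p]
        less.prems(5) by simp
    have kmaxH: "j \<le> Suc k" if "y \<in> carrier H" "H.ord y = p ^ j" for y j
    proof (cases j)
      case (Suc i)
      then have "\<exists>x\<in>carrier G. G.ord x = p ^ Suc i" using that tr[of i] by blast
      then show ?thesis using kmax Suc by blast
    qed simp
    obtain x y where x: "x \<in> carrier G" "G.ord x = p ^ Suc k" and y: "y \<in> carrier H" "H.ord y = p ^ Suc k"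
      using k tr by blast
    obtain K where K: "subgroup K G" and isoK: "integer_mod_group (p ^ Suc k) \<times>\<times> G\<lparr>carrier := K\<rparr> \<cong> G"
      by (rule G.split_off_cyclic[OF less.prems(2) p x kmax])
    obtain L where L: "subgroup L H" and isoL: "integer_mod_group (p ^ Suc k) \<times>\<times> H\<lparr>carrier := L\<rparr> \<cong> H"
      by (rule H.split_off_cyclic[OF less.prems(4) p y kmaxH])
    have gK: "comm_group (G\<lparr>carrier := K\<rparr>)" using K by (rule G.comm_group_subgroup)
    have gL: "comm_group (H\<lparr>carrier := L\<rparr>)" using L by (rule H.comm_group_subgroup)
    note gr = comm_group.axioms(2)[OF gK] comm_group.axioms(2)[OF gL]
    have pk: "p ^ Suc k > 0" using p by (simp add: prime_gt_0_nat)
    have nG: "nsol G m = gcd m (p ^ Suc k) * nsol (G\<lparr>carrier := K\<rparr>) m" for m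
      using nsol_iso[OF isoK] gr G.is_group pk
      by (simp add: DirProd_group nsol_DirProd nsol_integer_mod_group del: power_Suc)
    have nH: "nsol H m = gcd m (p ^ Suc k) * nsol (H\<lparr>carrier := L\<rparr>) m" for m
      using nsol_iso[OF isoL] gr H.is_group pk
      by (simp add: DirProd_group nsol_DirProd nsol_integer_mod_group del: power_Suc)
    have eq: "nsol (G\<lparr>carrier := K\<rparr>) m = nsol (H\<lparr>carrier := L\<rparr>) m" for m
      using nG[of m] nH[of m] less.prems(5)[of m] pk by (simp del: power_Suc)
    have finK: "finite (carrier (G\<lparr>carrier := K\<rparr>))" "finite (carrier (H\<lparr>carrier := L\<rparr>))"
      using K L less.prems(2,4) by (auto dest: subgroup.subset finite_subset)
    have "order G = p ^ Suc k * order (G\<lparr>carrier := K\<rparr>)"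
      using nG[of 0] by (simp add: nsol_0)
    moreover have "order (G\<lparr>carrier := K\<rparr>) > 0"
      using monoid.order_gt_0_iff_finite[OF group.is_monoid[OF gr(1)]] finK by simp
    moreover have "p ^ Suc k > 1" using p by (metis prime_gt_1_nat one_less_power zero_less_Suc)
    ultimately have "order (G\<lparr>carrier := K\<rparr>) < order G" by (simp del: power_Suc)
    then have "G\<lparr>carrier := K\<rparr> \<cong> H\<lparr>carrier := L\<rparr>"
      using less.hyps gK gL finK eq by blast
    then have "integer_mod_group (p ^ Suc k) \<times>\<times> G\<lparr>carrier := K\<rparr> \<cong> integer_mod_group (p ^ Suc k) \<times>\<times> H\<lparr>carrier := L\<rparr>"
      by (intro group.DirProd_iso_trans) (auto simp: iso_refl gr)
    then show ?thesis
      using iso_trans[OF iso_trans[OF group.iso_sym[OF _ isoK]] isoL]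
      by (simp add: DirProd_group gr)
  qed
qed

subsection \<open>Types of finite abelian groups\<close>

text \<open>A type is attached through the counts and not through an isomorphism with a product of
  cyclic groups. So it makes sense on every carrier type, and direct products need only a
  multiplication of numbers.\<close>

definition has_type :: "('a, 'b) monoid_scheme \<Rightarrow> nat multiset \<Rightarrow> bool" where
  "has_type G M \<longleftrightarrow> (\<forall>q\<in>#M. primepow q) \<and> (\<forall>m. nsol G m = (\<Prod>q\<in>#M. gcd m q))"

lemma has_type_iso: "G \<cong> H \<Longrightarrow> group G \<Longrightarrow> group H \<Longrightarrow> has_type G M \<longleftrightarrow> has_type H M"
  by (simp add: has_type_def nsol_iso)

lemma has_type_DirProd:
  "group G \<Longrightarrow> group H \<Longrightarrow> has_type G M \<Longrightarrow> has_type H N \<Longrightarrow> has_type (G \<times>\<times> H) (M + N)"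
  by (auto simp: has_type_def nsol_DirProd)

lemma has_type_integer_mod_group: "primepow q \<Longrightarrow> has_type (integer_mod_group q) {#q#}"
  by (auto simp: has_type_def nsol_integer_mod_group primepow_gt_0_nat)

lemma has_type_order: "has_type G M \<Longrightarrow> order G = prod_mset M"
  using nsol_0[of G] by (simp add: has_type_def)

lemma has_type_trivial: "group G \<Longrightarrow> order G = 1 \<Longrightarrow> has_type G {#}"
  unfolding has_type_def
proof (intro conjI allI)
  fix m :: nat assume G: "group G" "order G = 1"
  interpret group G by fact
  have "carrier G = {\<one>\<^bsub>G\<^esub>}" using G(2) by (metis card_1_singletonE one_closed order_def singletonD)
  then have "{x \<in> carrier G. x [^]\<^bsub>G\<^esub> m = \<one>\<^bsub>G\<^esub>} = {\<one>\<^bsub>G\<^esub>}" by (auto simp: nat_pow_one)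
  then show "nsol G m = (\<Prod>q\<in>#{#}. gcd m q)" by (simp add: nsol_def)
qed simp

lemma (in comm_group) split_off_prime_power:
  assumes fin: "finite (carrier G)" and ne: "order G \<noteq> 1"
  obtains q K where "primepow (q::nat)" "subgroup K G" "integer_mod_group q \<times>\<times> G\<lparr>carrier := K\<rparr> \<cong> G"
proof -
  obtain p x0 where p: "prime (p::nat)" and x0: "x0 \<in> carrier G" "ord x0 = p"
    using exists_ord_prime[OF fin ne] by blast
  obtain k where k: "\<exists>x\<in>carrier G. ord x = p ^ Suc k"
    and kmax: "\<And>y j. y \<in> carrier G \<Longrightarrow> ord y = p ^ j \<Longrightarrow> j \<le> Suc k"
    using exists_maximal_prime_power_order[OF fin x0 p] by blast
  then obtain x where x: "x \<in> carrier G" "ord x = p ^ Suc k" by blast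
  obtain K where K: "subgroup K G" "integer_mod_group (p ^ Suc k) \<times>\<times> G\<lparr>carrier := K\<rparr> \<cong> G"
    by (rule split_off_cyclic[OF fin p x kmax])
  have "primepow (p ^ Suc k)" using p by (simp add: primepow_prime_power del: power_Suc)
  then show thesis using K by (rule that)
qed

lemma has_type_exists:
  assumes "comm_group G" "finite (carrier G)"
  shows "\<exists>M. has_type G M"
  using assms
proof (induction "order G" arbitrary: G rule: less_induct)
  case (less G)
  interpret comm_group G by fact
  show ?case
  proof (cases "order G = 1")
    case True
    then show ?thesis using has_type_trivial is_group by blast
  next
    case False
    obtain q K where q: "primepow (q::nat)" and K: "subgroup K G"
      and iso: "integer_mod_group q \<times>\<times> G\<lparr>carrier := K\<rparr> \<cong> G"
      using split_off_prime_power[OF less.prems(2) False] by blast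
    let ?K = "G\<lparr>carrier := K\<rparr>"
    have cK: "comm_group ?K" using K by (rule comm_group_subgroup)
    then have gK: "group ?K" by (rule comm_group.axioms)
    have fK: "finite (carrier ?K)" using K less.prems(2) by (auto dest: subgroup.subset finite_subset)
    have "order G = q * order ?K"
      using nsol_iso[OF iso, of 0] gK is_group q
      by (simp add: DirProd_group nsol_DirProd nsol_integer_mod_group primepow_gt_0_nat flip: nsol_0)
    moreover have "order ?K > 0" using monoid.order_gt_0_iff_finite[OF group.is_monoid[OF gK]] fK by simp
    moreover have "q > 1" using q by (simp add: primepow_gt_Suc_0)
    ultimately have "order ?K < order G" by simp
    then obtain M where "has_type ?K M" using less.hyps cK fK by blast
    then have "has_type (integer_mod_group q \<times>\<times> ?K) ({#q#} + M)"
      using gK q by (intro has_type_DirProd has_type_integer_mod_group) auto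
    then show ?thesis using has_type_iso[OF iso] gK is_group by (auto simp: DirProd_group)
  qed
qed

lemma gcd_prime_power_Suc:
  assumes "prime (p::nat)"
  shows "gcd (p ^ Suc j) q = (if p ^ Suc j dvd q then p else 1) * gcd (p ^ j) q"
proof (cases "p ^ Suc j dvd q")
  case True
  then have "p ^ j dvd q" by (metis power_Suc dvd_mult_right)
  with True show ?thesis by (simp add: gcd_nat.absorb1)
next
  case False
  obtain i where i: "i \<le> Suc j" "gcd (p ^ Suc j) q = p ^ i"
    using assms by (metis divides_primepow_nat gcd_dvd1)
  moreover have "i \<noteq> Suc j" using i False by (metis gcd_dvd2)
  ultimately have "gcd (p ^ Suc j) q dvd p ^ j" by (simp add: le_imp_power_dvd)
  then have "gcd (p ^ Suc j) q dvd gcd (p ^ j) q" by simp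
  moreover have "gcd (p ^ j) q dvd gcd (p ^ Suc j) q" by (simp add: gcd_dvd1 dvd_mult)
  ultimately show ?thesis using False by (simp add: dvd_antisym del: power_Suc)
qed

text \<open>The quotient of two consecutive counts thus reveals how many members are divisible by
  p^(j+1).\<close>

lemma prod_mset_gcd_prime_power:
  assumes "prime (p::nat)"
  shows "(\<Prod>q\<in>#M. gcd (p ^ Suc j) q)
    = p ^ size (filter_mset (\<lambda>q. p ^ Suc j dvd q) M) * (\<Prod>q\<in>#M. gcd (p ^ j) q)"
  by (induction M) (simp_all add: gcd_prime_power_Suc[OF assms] del: power_Suc, simp)

lemma primepow_eq_iff_dvd:
  assumes "prime (p::nat)" "primepow q"
  shows "p ^ Suc j dvd q \<and> \<not> p ^ Suc (Suc j) dvd q \<longleftrightarrow> q = p ^ Suc j"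
proof -
  obtain r k where r: "prime r" "k > 0" "q = r ^ k" using assms(2) by (auto simp: primepow_def)
  have "1 < p" using assms(1) by (rule prime_gt_1_nat)
  show ?thesis
  proof
    assume l: "p ^ Suc j dvd q \<and> \<not> p ^ Suc (Suc j) dvd q"
    then have "p dvd r ^ k" using r by (metis power_Suc dvd_mult_left)
    then have "p = r" using assms(1) r(1) by (metis prime_dvd_power primes_dvd_imp_eq)
    then show "q = p ^ Suc j"
      using l \<open>1 < p\<close> r by (metis power_dvd_imp_le le_imp_power_dvd not_less_eq_eq le_antisym)
  next
    assume "q = p ^ Suc j"
    then show "p ^ Suc j dvd q \<and> \<not> p ^ Suc (Suc j) dvd q"
      using \<open>1 < p\<close> by (metis dvd_refl power_dvd_imp_le Suc_n_not_le_n)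
  qed
qed

text \<open>A prime power divisible by p^(j+1) but not by p^(j+2) is p^(j+1) itself.\<close>

lemma count_prime_power:
  assumes p: "prime (p::nat)" and M: "\<forall>q\<in>#M. primepow q"
  shows "size (filter_mset (\<lambda>q. p ^ Suc j dvd q) M)
    = count M (p ^ Suc j) + size (filter_mset (\<lambda>q. p ^ Suc (Suc j) dvd q) M)"
  using M
proof (induction M)
  case (add q M)
  have "p ^ Suc (Suc j) dvd q \<Longrightarrow> p ^ Suc j dvd q" by (metis power_Suc dvd_mult_right)
  then show ?case using add primepow_eq_iff_dvd[OF p, of q j] by (auto simp del: power_Suc)
qed simp

text \<open>The counts at p^i and p^(i+1) give the number of members divisible by p^(i+1); two
  consecutive such numbers differ by the multiplicity of p^(i+1) in the type.\<close>

lemma has_type_unique: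
  assumes "has_type G M" "has_type H N" "\<And>m. nsol G m = nsol H m"
  shows "M = N"
proof (rule multiset_eqI)
  fix x
  have eq: "(\<Prod>q\<in>#M. gcd m q) = (\<Prod>q\<in>#N. gcd m q)" for m
    using assms by (metis has_type_def)
  have pp: "\<forall>q\<in>#M. primepow q" "\<forall>q\<in>#N. primepow q" using assms by (simp_all add: has_type_def)
  show "count M x = count N x"
  proof (cases "primepow x")
    case False
    then have "x \<notin># M" "x \<notin># N" using pp by blast+
    then show ?thesis by (simp add: not_in_iff)
  next
    case True
    then obtain p k where p: "prime p" and "k > 0" "x = p ^ k" by (auto simp: primepow_def)
    then obtain j where x: "x = p ^ Suc j" by (cases k) auto
    have sz: "size (filter_mset (\<lambda>q. p ^ Suc i dvd q) M) = size (filter_mset (\<lambda>q. p ^ Suc i dvd q) N)" for i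
    proof -
      have "0 \<notin># image_mset (gcd (p ^ i)) N" using p by (auto simp: prime_gt_0_nat)
      then have nz: "(\<Prod>q\<in>#N. gcd (p ^ i) q) \<noteq> 0" by (simp add: prod_mset_zero_iff)
      have "p ^ size (filter_mset (\<lambda>q. p ^ Suc i dvd q) M) = p ^ size (filter_mset (\<lambda>q. p ^ Suc i dvd q) N)"
        using eq[of "p ^ Suc i"] eq[of "p ^ i"] mult_right_cancel[OF nz]
        unfolding prod_mset_gcd_prime_power[OF p] by simp
      then show ?thesis using prime_gt_1_nat[OF p] by (simp only: power_inject_exp)
    qed
    show ?thesis
      unfolding x using sz[of j] sz[of "Suc j"] count_prime_power[OF p pp(1), of j] count_prime_power[OF p pp(2), of j] by linarith
  qed
qed

lemma iso_iff_has_type: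
  assumes "comm_group G" "finite (carrier G)" "comm_group H" "finite (carrier H)"
    and "has_type G M" "has_type H N"
  shows "G \<cong> H \<longleftrightarrow> M = N"
proof
  assume "G \<cong> H"
  then show "M = N"
    using assms nsol_iso[of G H] by (metis comm_group.axioms(2) has_type_unique)
next
  assume "M = N"
  then have "nsol G m = nsol H m" for m using assms by (simp add: has_type_def)
  then show "G \<cong> H" using assms by (intro iso_if_nsol_eq)
qed

text \<open>Transport of structure along an injection of the carrier, since isomorphism classes are
  formed among groups on \<open>nat\<close> only.\<close>

lemma (in group) exists_iso_nat_group:
  assumes "finite (carrier G)"
  obtains H :: "nat monoid" where "group H" "G \<cong> H"
proof -
  obtain f :: "'a \<Rightarrow> nat" where f: "inj_on f (carrier G)"
    using assms by (metis finite_imp_inj_to_nat_seg)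
  define g where "g = inv_into (carrier G) f"
  have gf [simp]: "g (f x) = x" if "x \<in> carrier G" for x using f that by (simp add: g_def)
  define H :: "nat monoid" where
    "H = \<lparr>carrier = f ` carrier G, monoid.mult = (\<lambda>a b. f (g a \<otimes> g b)), one = f \<one>\<rparr>"
  have "f \<in> iso G H"
    using f by (auto simp: iso_def hom_def bij_betw_def H_def)
  moreover have "group H"
  proof (rule groupI)
    fix x assume "x \<in> carrier H"
    then obtain a where a: "a \<in> carrier G" "x = f a" by (auto simp: H_def)
    show "\<exists>y\<in>carrier H. y \<otimes>\<^bsub>H\<^esub> x = \<one>\<^bsub>H\<^esub>"
      by (rule bexI[of _ "f (inv a)"]) (use a in \<open>auto simp: H_def\<close>)
  qed (auto simp: H_def m_assoc)
  ultimately show thesis using that by (auto simp: is_iso_def)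
qed

lemma fin_ab_groupsD: "G \<in> fin_ab_groups \<Longrightarrow> comm_group G" "G \<in> fin_ab_groups \<Longrightarrow> group G"
  "G \<in> fin_ab_groups \<Longrightarrow> finite (carrier G)"
  by (auto simp: fin_ab_groups_def comm_group.axioms)

lemma comm_group_DirProd: "comm_group G \<Longrightarrow> comm_group H \<Longrightarrow> comm_group (G \<times>\<times> H)"
  by (rule group.group_comm_groupI)
    (auto simp: DirProd_group comm_group.axioms comm_monoid.m_comm[OF comm_group.axioms(1)])

lemma exists_group_of_type:
  assumes "\<forall>q\<in>#M. primepow q"
  shows "\<exists>G\<in>fin_ab_groups. has_type G M"
proof -
  \<comment> \<open>A product with a cyclic group lives on a type of pairs, so the induction below
    has to return to \<open>nat\<close> after every factor.\<close>
  have transfer: "\<exists>H\<in>fin_ab_groups. has_type H M"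
    if G: "comm_group G" "finite (carrier G)" "has_type G M" for G :: "'c monoid" and M
  proof -
    have gG: "group G" using G(1) by (rule comm_group.axioms)
    obtain H :: "nat monoid" where H: "group H" "G \<cong> H" using group.exists_iso_nat_group[OF gG G(2)] by blast
    have "comm_group H" using comm_group.iso_imp_comm_group[OF G(1) H(2)] H(1) by (simp add: group.is_monoid)
    moreover have "finite (carrier H)"
      using H(2) G(2) by (auto simp: is_iso_def iso_def dest: bij_betw_finite)
    moreover have "has_type H M" using has_type_iso[OF H(2) gG H(1)] G(3) by simp
    ultimately show ?thesis by (auto simp: fin_ab_groups_def)
  qed
  show ?thesis using assms
  proof (induction M)
    case empty
    have "has_type (integer_mod_group 1) {#}"
      by (rule has_type_trivial) (auto simp: order_def carrier_integer_mod_group)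
    then show ?case by (intro transfer) (auto simp: carrier_integer_mod_group)
  next
    case (add q M)
    then obtain H where H: "H \<in> fin_ab_groups" "has_type H M" by auto
    have q: "primepow q" using add.prems by simp
    have "has_type (integer_mod_group q \<times>\<times> H) ({#q#} + M)"
      using H q by (intro has_type_DirProd has_type_integer_mod_group) (auto dest: fin_ab_groupsD)
    moreover have "comm_group (integer_mod_group q \<times>\<times> H)"
      using H by (intro comm_group_DirProd) (auto dest: fin_ab_groupsD)
    moreover have "finite (carrier (integer_mod_group q \<times>\<times> H))"
      using H q by (auto dest: fin_ab_groupsD simp: carrier_integer_mod_group)
    ultimately show ?case using transfer by fastforce
  qed
qed

subsection \<open>Unitary factors\<close>

definition group_of_type :: "nat multiset \<Rightarrow> nat monoid" where
  "group_of_type M = (SOME G. G \<in> fin_ab_groups \<and> has_type G M)"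

lemma group_of_type:
  assumes "\<forall>q\<in>#M. primepow q"
  shows "group_of_type M \<in> fin_ab_groups" "has_type (group_of_type M) M"
proof -
  have "\<exists>G. G \<in> fin_ab_groups \<and> has_type G M" using exists_group_of_type[OF assms] by blast
  then have "group_of_type M \<in> fin_ab_groups \<and> has_type (group_of_type M) M"
    unfolding group_of_type_def by (rule someI_ex)
  then show "group_of_type M \<in> fin_ab_groups" "has_type (group_of_type M) M" by auto
qed

lemma has_type_primepow: "has_type G M \<Longrightarrow> \<forall>q\<in>#M. primepow q"
  by (simp add: has_type_def)

lemma fin_ab_groups_iso_iff:
  assumes "G \<in> fin_ab_groups" "H \<in> fin_ab_groups" "has_type G M" "has_type H N"
  shows "G \<cong> H \<longleftrightarrow> M = N"
  using assms by (intro iso_iff_has_type) (auto dest: fin_ab_groupsD)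

lemma fin_ab_groups_has_type: "G \<in> fin_ab_groups \<Longrightarrow> \<exists>M. has_type G M"
  by (auto intro!: has_type_exists dest: fin_ab_groupsD)

lemma iso_DirProd_iff_has_type:
  assumes "G \<in> fin_ab_groups" "H \<in> fin_ab_groups" "K \<in> fin_ab_groups"
    and "has_type G M" "has_type H A" "has_type K B"
  shows "G \<cong> H \<times>\<times> K \<longleftrightarrow> M = A + B"
  using assms by (intro iso_iff_has_type has_type_DirProd comm_group_DirProd) (auto dest: fin_ab_groupsD)

text \<open>Types add in direct products, and a group of type \<open>M - A\<close> supplies the
  complementary factor.\<close>

lemma is_direct_factor_iff:
  assumes "D \<in> fin_ab_groups" "G \<in> fin_ab_groups" "has_type D A" "has_type G M"
  shows "is_direct_factor D G \<longleftrightarrow> A \<subseteq># M"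
proof
  assume "is_direct_factor D G"
  then obtain L where L: "L \<in> fin_ab_groups" "G \<cong> D \<times>\<times> L" by (auto simp: is_direct_factor_def)
  then obtain B where "has_type L B" using fin_ab_groups_has_type by blast
  then have "M = A + B" using iso_DirProd_iff_has_type assms L by blast
  then show "A \<subseteq># M" by simp
next
  assume A: "A \<subseteq># M"
  let ?L = "group_of_type (M - A)"
  have "\<forall>q\<in>#M - A. primepow q" using has_type_primepow[OF assms(4)] by (auto dest: in_diffD)
  note L = group_of_type[OF this]
  have "G \<cong> D \<times>\<times> ?L" using A assms L by (subst iso_DirProd_iff_has_type) auto
  then show "is_direct_factor D G" using L assms by (auto simp: is_direct_factor_def)
qed

lemma carrier_trivial_iff_has_type:
  assumes "G \<in> fin_ab_groups" "has_type G M"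
  shows "carrier G = {\<one>\<^bsub>G\<^esub>} \<longleftrightarrow> M = {#}"
proof -
  have "carrier G = {\<one>\<^bsub>G\<^esub>} \<longleftrightarrow> order G = 1"
    using fin_ab_groupsD(2)[OF assms(1)]
    by (metis card_1_singletonE group.is_monoid monoid.one_closed order_def singletonD is_singletonI is_singleton_altdef)
  also have "\<dots> \<longleftrightarrow> prod_mset M = 1" using has_type_order[OF assms(2)] by simp
  also have "\<dots> \<longleftrightarrow> M = {#}"
  proof
    assume "prod_mset M = 1"
    then have "\<forall>q\<in>#M. q = 1" using dvd_prod_mset by fastforce
    then show "M = {#}" using has_type_primepow[OF assms(2)]
      by (metis One_nat_def less_irrefl multiset_nonemptyE primepow_gt_Suc_0)
  qed simp
  finally show ?thesis .
qed

text \<open>The group of type \<open>A \<inter># B\<close> is the largest common direct factor, so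
  it suffices to know when it is trivial.\<close>

lemma unitary_factors_iff:
  assumes "G \<in> fin_ab_groups" "H \<in> fin_ab_groups" "K \<in> fin_ab_groups"
    and "has_type G M" "has_type H A" "has_type K B"
  shows "unitary_factors G H K \<longleftrightarrow> M = A + B \<and> A \<inter># B = {#}"
proof -
  have "(\<forall>D. is_direct_factor D H \<and> is_direct_factor D K \<longrightarrow> carrier D = {\<one>\<^bsub>D\<^esub>}) \<longleftrightarrow> A \<inter># B = {#}"
    (is "?L \<longleftrightarrow> _")
  proof
    assume ?L
    have pp: "\<forall>q\<in>#A \<inter># B. primepow q" using has_type_primepow[OF assms(5)] by auto
    let ?D = "group_of_type (A \<inter># B)"
    note D = group_of_type[OF pp]
    have "is_direct_factor ?D H" "is_direct_factor ?D K"
      using is_direct_factor_iff D assms by auto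
    with \<open>?L\<close> have "carrier ?D = {\<one>\<^bsub>?D\<^esub>}" by blast
    then show "A \<inter># B = {#}" using carrier_trivial_iff_has_type D by blast
  next
    assume AB: "A \<inter># B = {#}"
    show ?L
    proof (intro allI impI)
      fix D assume D: "is_direct_factor D H \<and> is_direct_factor D K"
      then have "D \<in> fin_ab_groups" by (auto simp: is_direct_factor_def)
      moreover obtain C where "has_type D C" using fin_ab_groups_has_type \<open>D \<in> fin_ab_groups\<close> by blast
      moreover have "C \<subseteq># A \<inter># B" using calculation D is_direct_factor_iff assms by (metis subset_mset.inf_greatest)
      ultimately show "carrier D = {\<one>\<^bsub>D\<^esub>}" using AB carrier_trivial_iff_has_type by auto
    qed
  qed
  then show ?thesis using iso_DirProd_iff_has_type[OF assms] by (simp add: unitary_factors_def)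
qed

lemma iso_rel_class_eq_iff:
  assumes "G \<in> fin_ab_groups" "H \<in> fin_ab_groups" "has_type G M" "has_type H N"
  shows "iso_rel `` {G} = iso_rel `` {H} \<longleftrightarrow> M = N"
  using eq_equiv_class_iff[OF equiv_iso_rel assms(1,2)] fin_ab_groups_iso_iff[OF assms] assms
  by (simp add: iso_rel_def)

text \<open>In a disjoint splitting, A takes all copies of each of its members, so it is the
  restriction of M to an arbitrary subset of the support. The same count serves later for coprime
  factorizations.\<close>

lemma card_unitary_splittings: "card {A. \<exists>B. M = A + B \<and> A \<inter># B = {#}} = 2 ^ card (set_mset M)"
proof -
  let ?f = "\<lambda>S. filter_mset (\<lambda>x. x \<in> S) M"
  have "{A. \<exists>B. M = A + B \<and> A \<inter># B = {#}} = ?f ` Pow (set_mset M)"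
  proof (intro equalityI subsetI)
    fix A assume "A \<in> {A. \<exists>B. M = A + B \<and> A \<inter># B = {#}}"
    then obtain B where B: "M = A + B" "A \<inter># B = {#}" by blast
    have "x \<notin># B" if "x \<in># A" for x using B(2) that by (simp add: disjunct_not_in)
    then have "filter_mset (\<lambda>x. x \<in># A) B = {#}" by (auto simp: filter_mset_eq_conv)
    moreover have "filter_mset (\<lambda>x. x \<in># A) A = A" by (simp add: filter_mset_eq_conv)
    ultimately have "?f (set_mset A) = A" using B(1) by simp
    then show "A \<in> ?f ` Pow (set_mset M)" using B(1) by (metis PowI image_eqI set_mset_union Un_upper1)
  next
    fix A assume "A \<in> ?f ` Pow (set_mset M)"
    then obtain S where S: "A = ?f S" by blast
    have "M = A + filter_mset (\<lambda>x. x \<notin> S) M" by (simp add: S)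
    moreover have "A \<inter># filter_mset (\<lambda>x. x \<notin> S) M = {#}" by (auto simp: S disjunct_not_in)
    ultimately show "A \<in> {A. \<exists>B. M = A + B \<and> A \<inter># B = {#}}" by blast
  qed
  moreover have "inj_on ?f (Pow (set_mset M))"
  proof (rule inj_onI)
    fix S T assume "S \<in> Pow (set_mset M)" "T \<in> Pow (set_mset M)" "?f S = ?f T"
    then have "set_mset (?f S) = set_mset (?f T)" "S \<subseteq> set_mset M" "T \<subseteq> set_mset M" by auto
    then show "S = T" by auto
  qed
  ultimately show ?thesis by (simp add: card_image card_Pow)
qed

lemma num_unitary_factors_eq:
  assumes "G \<in> fin_ab_groups" "has_type G M"
  shows "num_unitary_factors G = 2 ^ card (set_mset M)"
proof -
  let ?S = "{A. \<exists>B. M = A + B \<and> A \<inter># B = {#}}"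
  let ?f = "\<lambda>A. iso_rel `` {group_of_type A}"
  have pp: "(\<forall>q\<in>#A. primepow q) \<and> (\<forall>q\<in>#B. primepow q)" if "M = A + B" for A B
    using that has_type_primepow[OF assms(2)] by auto
  have "{iso_rel `` {H} | H. H \<in> fin_ab_groups \<and> (\<exists>K \<in> fin_ab_groups. unitary_factors G H K)} = ?f ` ?S"
  proof (intro equalityI subsetI)
    fix C assume "C \<in> {iso_rel `` {H} | H. H \<in> fin_ab_groups \<and> (\<exists>K \<in> fin_ab_groups. unitary_factors G H K)}"
    then obtain H K where H: "C = iso_rel `` {H}" "H \<in> fin_ab_groups" "K \<in> fin_ab_groups" "unitary_factors G H K"
      by blast
    obtain A B where AB: "has_type H A" "has_type K B" using H fin_ab_groups_has_type by meson
    then have *: "M = A + B" "A \<inter># B = {#}" using unitary_factors_iff[OF assms(1) H(2,3) assms(2) AB] H(4) by auto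
    moreover have "C = ?f A" using iso_rel_class_eq_iff H AB group_of_type[of A] pp[OF *(1)] by blast
    ultimately show "C \<in> ?f ` ?S" by blast
  next
    fix C assume "C \<in> ?f ` ?S"
    then obtain A B where AB: "C = ?f A" "M = A + B" "A \<inter># B = {#}" by blast
    have "unitary_factors G (group_of_type A) (group_of_type B)"
      using unitary_factors_iff[OF assms(1) group_of_type(1) group_of_type(1) assms(2) group_of_type(2) group_of_type(2)]
        pp[OF AB(2)] AB by auto
    then show "C \<in> {iso_rel `` {H} | H. H \<in> fin_ab_groups \<and> (\<exists>K \<in> fin_ab_groups. unitary_factors G H K)}"
      using AB group_of_type(1) pp[OF AB(2)] by blast
  qed
  moreover have "inj_on ?f ?S"
  proof (rule inj_onI)
    fix A A' assume "A \<in> ?S" "A' \<in> ?S" and eq: "?f A = ?f A'"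
    then have "\<forall>q\<in>#A. primepow q" "\<forall>q\<in>#A'. primepow q" using pp by blast+
    then show "A = A'" using eq iso_rel_class_eq_iff group_of_type by blast
  qed
  ultimately show ?thesis by (simp add: num_unitary_factors_def card_image card_unitary_splittings)
qed

subsection \<open>Rank\<close>

text \<open>The fibres over the image are translates of the kernel.\<close>

lemma (in group_hom) card_carrier_eq_card_kernel:
  assumes "finite (carrier G)"
  shows "card (carrier G) = card (h ` carrier G) * card {x \<in> carrier G. h x = \<one>\<^bsub>H\<^esub>}"
proof -
  let ?F = "\<lambda>y. {x \<in> carrier G. h x = y}"
  have "card (?F y) = card (?F \<one>\<^bsub>H\<^esub>)" if y: "y \<in> h ` carrier G" for y
  proof -
    obtain a where a: "a \<in> carrier G" "y = h a" using y by blast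
    have "bij_betw (\<lambda>x. a \<otimes>\<^bsub>G\<^esub> x) (?F \<one>\<^bsub>H\<^esub>) (?F y)"
    proof (rule bij_betwI[where g = "\<lambda>x. inv\<^bsub>G\<^esub> a \<otimes>\<^bsub>G\<^esub> x"])
      show "(\<lambda>x. a \<otimes>\<^bsub>G\<^esub> x) \<in> ?F \<one>\<^bsub>H\<^esub> \<rightarrow> ?F y" using a by simp
      show "(\<lambda>x. inv\<^bsub>G\<^esub> a \<otimes>\<^bsub>G\<^esub> x) \<in> ?F y \<rightarrow> ?F \<one>\<^bsub>H\<^esub>" using a by simp
      show "inv\<^bsub>G\<^esub> a \<otimes>\<^bsub>G\<^esub> (a \<otimes>\<^bsub>G\<^esub> x) = x" if "x \<in> ?F \<one>\<^bsub>H\<^esub>" for x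
        using a that by (simp flip: G.m_assoc)
      show "a \<otimes>\<^bsub>G\<^esub> (inv\<^bsub>G\<^esub> a \<otimes>\<^bsub>G\<^esub> x) = x" if "x \<in> ?F y" for x
        using a that by (simp flip: G.m_assoc)
    qed
    then show ?thesis by (simp add: bij_betw_same_card)
  qed
  then have "(\<Sum>y\<in>h ` carrier G. card (?F y)) = card (h ` carrier G) * card (?F \<one>\<^bsub>H\<^esub>)" by simp
  moreover have "(\<Sum>y\<in>h ` carrier G. card (?F y)) = card (\<Union>y\<in>h ` carrier G. ?F y)"
    using assms by (subst card_UN_disjoint) auto
  moreover have "(\<Union>y\<in>h ` carrier G. ?F y) = carrier G" by auto
  ultimately show ?thesis by simp
qed

text \<open>Modulo m-th powers every element is a product of generators with exponents below m:
  exponents only count modulo m in the quotient by the m-th powers.\<close>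

lemma (in comm_group) generated_mod_powers:
  assumes S: "finite S" "S \<subseteq> carrier G" and m: "m > 0" and x: "x \<in> generate G S"
  shows "\<exists>e\<in>S \<rightarrow>\<^sub>E {..<m}. \<exists>y\<in>carrier G. x = finprod G (\<lambda>s. s [^] (e s :: nat)) S \<otimes> y [^] (m :: nat)"
proof -
  have P: "(\<lambda>s. s [^] (e s :: nat)) \<in> S \<rightarrow> carrier G" for e using S by auto
  \<comment> \<open>Writing e s = (e s mod m) + m (e s div m) moves the multiples of m into the m-th
    power, so the induction over \<open>generate\<close> may use unrestricted exponents.\<close>
  have red: "\<exists>e\<in>S \<rightarrow>\<^sub>E {..<m}. \<exists>y\<in>carrier G. x = finprod G (\<lambda>s. s [^] (e s :: nat)) S \<otimes> y [^] m"
    if e: "x = finprod G (\<lambda>s. s [^] (e s :: nat)) S \<otimes> y [^] m" "y \<in> carrier G" for x y e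
  proof (intro bexI)
    let ?z = "finprod G (\<lambda>s. s [^] (e s div m)) S"
    have "finprod G (\<lambda>s. s [^] e s) S = finprod G (\<lambda>s. s [^] (e s mod m) \<otimes> (s [^] (e s div m)) [^] m) S"
      using S by (intro finprod_cong') (auto simp: nat_pow_pow nat_pow_mult mult.commute)
    also have "\<dots> = finprod G (\<lambda>s. s [^] (e s mod m)) S \<otimes> finprod G (\<lambda>s. (s [^] (e s div m)) [^] m) S"
      using S by (intro finprod_multf) auto
    also have "finprod G (\<lambda>s. (s [^] (e s div m)) [^] m) S = ?z [^] m"
      using S by (induction S rule: finite_induct) (auto simp: nat_pow_distrib Pi_def subset_iff)
    also have "finprod G (\<lambda>s. s [^] (e s mod m)) S = finprod G (\<lambda>s. s [^] (restrict (\<lambda>s. e s mod m) S s)) S"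
      using S by (intro finprod_cong') auto
    finally show "x = finprod G (\<lambda>s. s [^] (restrict (\<lambda>s. e s mod m) S s)) S \<otimes> (?z \<otimes> y) [^] m"
      using e P[of "restrict (\<lambda>s. e s mod m) S"] P[of "\<lambda>s. e s div m"]
      by (simp only: nat_pow_distrib m_assoc nat_pow_closed finprod_closed)
    show "?z \<otimes> y \<in> carrier G" using P e by auto
    show "restrict (\<lambda>s. e s mod m) S \<in> S \<rightarrow>\<^sub>E {..<m}" using m by auto
  qed
  from x have "\<exists>e. \<exists>y\<in>carrier G. x = finprod G (\<lambda>s. s [^] (e s :: nat)) S \<otimes> y [^] m"
  proof (induction rule: generate.induct)
    case one
    show ?case using S by (intro exI[of _ "\<lambda>_. 0"] bexI[of _ \<one>]) (auto simp: nat_pow_one)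
  next
    case (incl s)
    have "finprod G (\<lambda>t. t [^] (if t = s then 1 else 0 :: nat)) S = finprod G (\<lambda>t. if s = t then t else \<one>) S"
      using S by (intro finprod_cong') auto
    also have "\<dots> = s" using S incl by (intro finprod_singleton) auto
    finally show ?case
      using S incl by (intro exI[of _ "\<lambda>t. if t = s then 1 else 0"] bexI[of _ \<one>]) (auto simp: nat_pow_one)
  next
    case (inv s)
    have s: "s \<in> carrier G" using inv S by blast
    \<comment> \<open>Exponents are natural numbers, so the inverse of s is written as s^(m-1) times
      the m-th power of the inverse.\<close>
    have "finprod G (\<lambda>t. t [^] (if t = s then m - 1 else 0 :: nat)) S = finprod G (\<lambda>t. if s = t then t [^] (m - 1) else \<one>) S"
      using S by (intro finprod_cong') auto
    also have "\<dots> = s [^] (m - 1)" using S inv by (intro finprod_singleton) auto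
    finally have "inv s = finprod G (\<lambda>t. t [^] (if t = s then m - 1 else 0 :: nat)) S \<otimes> (inv s) [^] m"
    proof -
      assume *: "finprod G (\<lambda>t. t [^] (if t = s then m - 1 else 0 :: nat)) S = s [^] (m - 1)"
      have "s [^] (m - 1) \<otimes> inv s [^] m = s [^] (m - 1) \<otimes> (inv s [^] (m - 1) \<otimes> inv s)"
        using m s by (cases m) auto
      also have "\<dots> = (s \<otimes> inv s) [^] (m - 1) \<otimes> inv s" using s by (subst nat_pow_distrib) (auto simp: m_assoc)
      also have "\<dots> = inv s" using s by (simp add: nat_pow_one)
      finally show ?thesis using * by simp
    qed
    then show ?case using s
      by (intro exI[of _ "\<lambda>t. if t = s then m - 1 else 0"] bexI[of _ "inv s"]) (assumption | simp)+
  next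
    case (eng x x')
    then obtain e y e' y' where *: "y \<in> carrier G" "x = finprod G (\<lambda>s. s [^] (e s :: nat)) S \<otimes> y [^] m"
      "y' \<in> carrier G" "x' = finprod G (\<lambda>s. s [^] (e' s :: nat)) S \<otimes> y' [^] m" by blast
    have "finprod G (\<lambda>s. s [^] (e s + e' s)) S = finprod G (\<lambda>s. s [^] e s \<otimes> s [^] e' s) S"
      using S by (intro finprod_cong') (auto simp: nat_pow_mult)
    also have "\<dots> = finprod G (\<lambda>s. s [^] e s) S \<otimes> finprod G (\<lambda>s. s [^] e' s) S"
      by (rule finprod_multf[OF P P])
    finally have "x \<otimes> x' = finprod G (\<lambda>s. s [^] (e s + e' s)) S \<otimes> (y \<otimes> y') [^] m"
      using * P[of e] P[of e'] by (simp add: nat_pow_distrib m_ac)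
    then show ?case using *
      by (intro exI[of _ "\<lambda>s. e s + e' s"] bexI[of _ "y \<otimes> y'"]) (assumption | simp)+
  qed
  then show ?thesis using red by blast
qed

text \<open>For the endomorphism x -> x^m with image P, the order of G equals |P| times
  \<open>nsol G m\<close>. By \<open>generated_mod_powers\<close> it is also at most m^|S|
  |P|.\<close>

lemma (in comm_group) nsol_le_power_card_generators:
  assumes fin: "finite (carrier G)" and S: "finite S" "S \<subseteq> carrier G" "generate G S = carrier G" and m: "m > 0"
  shows "nsol G m \<le> m ^ card S"
proof -
  interpret h: group_hom G G "\<lambda>x. x [^] m"
    by unfold_locales (auto simp: hom_def nat_pow_distrib)
  let ?P = "(\<lambda>x. x [^] m) ` carrier G"
  let ?f = "\<lambda>(e, y). finprod G (\<lambda>s. s [^] (e s :: nat)) S \<otimes> y"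
  have "carrier G \<subseteq> ?f ` ((S \<rightarrow>\<^sub>E {..<m}) \<times> ?P)"
  proof
    fix x assume "x \<in> carrier G"
    then obtain e y where "e \<in> S \<rightarrow>\<^sub>E {..<m}" "y \<in> carrier G" "x = finprod G (\<lambda>s. s [^] (e s :: nat)) S \<otimes> y [^] m"
      using generated_mod_powers[OF S(1,2) m, of x] S(3) by auto
    then show "x \<in> ?f ` ((S \<rightarrow>\<^sub>E {..<m}) \<times> ?P)" by (intro image_eqI[of _ _ "(e, y [^] m)"]) auto
  qed
  then have "card (carrier G) \<le> card ((S \<rightarrow>\<^sub>E {..<m}) \<times> ?P)"
    using fin S by (intro surj_card_le) (auto intro: finite_PiE)
  also have "\<dots> = m ^ card S * card ?P" using S by (simp add: card_cartesian_product card_PiE)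
  finally have "card ?P * nsol G m \<le> card ?P * m ^ card S"
    using h.card_carrier_eq_card_kernel[OF fin] by (simp add: nsol_def mult.commute)
  moreover have "card ?P > 0" using fin by (auto simp: card_gt_0_iff)
  ultimately show ?thesis by simp
qed

lemma (in group) group_rank_generators:
  assumes "finite (carrier G)"
  obtains S where "S \<subseteq> carrier G" "finite S" "card S = group_rank G" "generate G S = carrier G"
proof -
  have "generate G (carrier G) = carrier G" by (auto intro: generate.incl dest: generate_in_carrier[rotated])
  then have "\<exists>n. \<exists>S \<subseteq> carrier G. finite S \<and> card S = n \<and> generate G S = carrier G"
    using assms by blast
  then have "\<exists>S \<subseteq> carrier G. finite S \<and> card S = group_rank G \<and> generate G S = carrier G"
    unfolding group_rank_def by (rule LeastI_ex)
  then show thesis using that by blast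
qed

lemma group_rank_le:
  assumes "S \<subseteq> carrier G" "finite S" "card S \<le> n" "generate G S = carrier G"
  shows "group_rank G \<le> n"
proof -
  have "group_rank G \<le> card S" unfolding group_rank_def using assms by (intro Least_le) blast
  with assms(3) show ?thesis by simp
qed

lemma (in comm_group) nsol_le_power_group_rank:
  assumes "finite (carrier G)" "m > 0"
  shows "nsol G m \<le> m ^ group_rank G"
  using group_rank_generators[OF assms(1)] nsol_le_power_card_generators[OF assms(1) _ _ _ assms(2)] by metis

lemma group_rank_le_iso:
  assumes "G \<cong> H" "group G" "group H" "finite (carrier G)"
  shows "group_rank H \<le> group_rank G"
proof -
  obtain f where f: "f \<in> iso G H" using assms by (auto simp: is_iso_def)
  interpret f: group_hom G H f
    using assms f by (simp add: group_hom_def group_hom_axioms_def iso_def)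
  obtain S where S: "S \<subseteq> carrier G" "finite S" "card S = group_rank G" "generate G S = carrier G"
    using group.group_rank_generators[OF assms(2,4)] by blast
  have "f ` carrier G = carrier H" using f by (simp add: iso_def bij_betw_def)
  then show ?thesis
    using S f.generate_img[OF S(1)] card_image_le[OF S(2), of f] by (intro group_rank_le[of "f ` S"]) auto
qed

lemma comm_group_product_group:
  assumes "\<And>i. i \<in> I \<Longrightarrow> comm_group (G i)"
  shows "comm_group (product_group I G)"
  using assms by (intro group.group_comm_groupI product_group)
    (auto simp: comm_group.axioms PiE_iff intro!: restrict_ext comm_monoid.m_comm[OF comm_group.axioms(1)])

text \<open>The unit vectors generate the product.\<close>

lemma group_rank_product_cyclic_le:
  assumes n: "\<And>i. i < r \<Longrightarrow> n i > 0"
  shows "group_rank (product_group {..<r} (\<lambda>i. integer_mod_group (n i))) \<le> r" (is "group_rank ?G \<le> r")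
proof -
  interpret group ?G by simp
  \<comment> \<open>For n i = 1 the cyclic group is {0}, and \<open>1 mod int (n i)\<close> gives
    the right entry 0.\<close>
  define u where "u = (\<lambda>j. restrict (\<lambda>i. if i = j then 1 mod int (n i) else 0) {..<r})"
  have u: "u j \<in> carrier ?G" for j
    using n by (auto simp: u_def carrier_integer_mod_group PiE_iff)
  let ?S = "u ` {..<r}"
  have upow: "u j [^]\<^bsub>?G\<^esub> (a :: nat) = restrict (\<lambda>i. if i = j then int a mod int (n i) else 0) {..<r}" for a j
  proof (induction a)
    case (Suc a)
    have "u j [^]\<^bsub>?G\<^esub> Suc a = u j [^]\<^bsub>?G\<^esub> a \<otimes>\<^bsub>?G\<^esub> u j" by simp
    also have "\<dots> = restrict (\<lambda>i. if i = j then int (Suc a) mod int (n i) else 0) {..<r}"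
      unfolding Suc.IH by (rule ext) (auto simp: u_def mod_simps add.commute)
    finally show ?case .
  qed (auto simp: restrict_def fun_eq_iff)
  \<comment> \<open>Induction on a bound k for the support of x: a power of the last unit vector
    accounts for the last coordinate, and the rest has a smaller bound.\<close>
  have "x \<in> generate ?G ?S" if "x \<in> carrier ?G" "\<forall>i<r. i \<ge> k \<longrightarrow> x i = 0" "k \<le> r" for x k
    using that
  proof (induction k arbitrary: x)
    case 0
    then have "x = \<one>\<^bsub>?G\<^esub>" by (auto simp: PiE_iff extensional_def fun_eq_iff)
    then show ?case by (simp only: generate.one)
  next
    case (Suc k)
    have k: "k < r" using Suc.prems by simp
    have xk: "0 \<le> x i" "x i < int (n i)" if "i < r" for i
    proof -
      have "x i \<in> carrier (integer_mod_group (n i))" using Suc.prems(1) that by (auto simp: PiE_iff)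
      then show "0 \<le> x i" "x i < int (n i)" using n[OF that] by (simp_all add: carrier_integer_mod_group)
    qed
    define y where "y = x(k := 0)"
    have y: "y \<in> carrier ?G" using Suc.prems(1) k by (auto simp: y_def PiE_iff extensional_def)
    have "y \<in> generate ?G ?S"
      using Suc.prems(2) k by (intro Suc.IH y) (auto simp: y_def Suc_le_eq nat_less_le)
    moreover have "u k [^]\<^bsub>?G\<^esub> nat (x k) \<in> generate ?G ?S"
    proof -
      have "u k \<in> generate ?G ?S" using k by (auto intro: generate.incl)
      moreover have "subgroup (generate ?G ?S) ?G" using u by (intro generate_is_subgroup) auto
      ultimately have "u k [^]\<^bsub>?G\<^esub> int (nat (x k)) \<in> generate ?G ?S" by (intro subgroup_int_pow_closed)
      then show ?thesis by (simp only: int_pow_int)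
    qed
    moreover have "x = y \<otimes>\<^bsub>?G\<^esub> (u k [^]\<^bsub>?G\<^esub> nat (x k))"
      unfolding upow using Suc.prems(1) xk k by (auto simp: y_def fun_eq_iff PiE_iff extensional_def)
    ultimately show ?case by (metis generate.eng)
  qed
  from this[of _ r] have "carrier ?G \<subseteq> generate ?G ?S" by auto
  moreover have "generate ?G ?S \<subseteq> carrier ?G" using u by (intro generate_incl) auto
  ultimately show ?thesis
    using u card_image_le[of "{..<r}" u] by (intro group_rank_le[of ?S]) auto
qed

text \<open>By \<open>iso_if_nsol_eq\<close> these counts identify the group with a product of r
  cyclic groups. The moduli n i may be arbitrary positive numbers, not only prime powers.\<close>

lemma group_rank_le_if_nsol:
  assumes "comm_group G" "finite (carrier G)" and n: "\<And>i. i < r \<Longrightarrow> n i > 0"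
    and "\<And>m. nsol G m = (\<Prod>i<r. gcd m (n i))"
  shows "group_rank G \<le> r"
proof -
  let ?H = "product_group {..<r} (\<lambda>i. integer_mod_group (n i))"
  have cH: "comm_group ?H" by (rule comm_group_product_group) simp
  have fH: "finite (carrier ?H)" using n by (auto simp: carrier_integer_mod_group intro!: finite_PiE)
  have "?H \<cong> G"
    using assms cH fH by (intro iso_if_nsol_eq) (auto simp: nsol_product_group nsol_integer_mod_group)
  then have "group_rank G \<le> group_rank ?H"
    using cH fH assms(1) by (intro group_rank_le_iso) (auto simp: comm_group.axioms)
  also have "\<dots> \<le> r" using n by (rule group_rank_product_cyclic_le)
  finally show ?thesis .
qed

subsection \<open>Conjugate groups\<close>

lemma nat_pow_carrier_update [simp]:
  fixes m :: nat
  shows "x [^]\<^bsub>G\<lparr>carrier := K\<rparr>\<^esub> m = x [^]\<^bsub>G\<^esub> m"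
  by (induction m) (simp_all add: nat_pow_def)

lemma prime_power_dvd_iff_eq:
  assumes "prime (p::nat)" "primepow q" "p dvd q"
  shows "q = p ^ multiplicity p q"
proof -
  obtain r k where r: "prime r" "q = r ^ k" using assms(2) by (auto simp: primepow_def)
  then have "p = r" using assms(1,3) by (metis prime_dvd_power primes_dvd_imp_eq)
  then show ?thesis using r by simp
qed

lemma subgroup_primary_component:
  assumes "comm_group G"
  shows "subgroup {x \<in> carrier G. \<exists>k::nat. x [^]\<^bsub>G\<^esub> ((p::nat) ^ k) = \<one>\<^bsub>G\<^esub>} G"
proof -
  interpret comm_group G by fact
  show ?thesis
  proof (rule subgroupI)
    fix x y assume "x \<in> {x \<in> carrier G. \<exists>k::nat. x [^]\<^bsub>G\<^esub> (p ^ k) = \<one>\<^bsub>G\<^esub>}"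
      "y \<in> {x \<in> carrier G. \<exists>k::nat. x [^]\<^bsub>G\<^esub> (p ^ k) = \<one>\<^bsub>G\<^esub>}"
    then obtain j k where jk: "x \<in> carrier G" "y \<in> carrier G" "x [^]\<^bsub>G\<^esub> (p ^ j) = \<one>\<^bsub>G\<^esub>" "y [^]\<^bsub>G\<^esub> (p ^ k) = \<one>\<^bsub>G\<^esub>"
      by blast
    then have "x [^]\<^bsub>G\<^esub> (p ^ (j + k)) = \<one>\<^bsub>G\<^esub>" "y [^]\<^bsub>G\<^esub> (p ^ (j + k)) = \<one>\<^bsub>G\<^esub>"
      by (simp_all add: pow_eq_id power_add)
    then have "(x \<otimes>\<^bsub>G\<^esub> y) [^]\<^bsub>G\<^esub> (p ^ (j + k)) = \<one>\<^bsub>G\<^esub>" using jk by (simp add: nat_pow_distrib)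
    then show "x \<otimes>\<^bsub>G\<^esub> y \<in> {x \<in> carrier G. \<exists>k::nat. x [^]\<^bsub>G\<^esub> (p ^ k) = \<one>\<^bsub>G\<^esub>}" using jk by blast
  next
    show "{x \<in> carrier G. \<exists>k::nat. x [^]\<^bsub>G\<^esub> (p ^ k) = \<one>\<^bsub>G\<^esub>} \<noteq> {}"
      by (auto intro!: exI[of _ "\<one>\<^bsub>G\<^esub>"] simp: nat_pow_one)
  qed (auto simp: nat_pow_inv)
qed

text \<open>Let a be the multiplicity of p in the order. An element has p-power order exactly when
  its p^a-th power is 1, so the m-solutions in the component are the solutions for gcd m (p^a) in G.
  In the gcd with q, only members divisible by p survive.\<close>

lemma has_type_primary_component:
  assumes G: "comm_group G" "finite (carrier G)" and M: "has_type G M" and p: "prime (p::nat)"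
  shows "has_type (primary_component p G) (filter_mset (\<lambda>q. p dvd q) M)"
  unfolding has_type_def
proof (intro conjI allI)
  interpret comm_group G by fact
  show "\<forall>q\<in>#filter_mset (\<lambda>q. p dvd q) M. primepow q" using has_type_primepow[OF M] by auto
  fix m :: nat
  have oG: "order G \<noteq> 0" using order_gt_0_iff_finite G by simp
  define a where "a = multiplicity p (order G)"
  have "(\<exists>k. x [^]\<^bsub>G\<^esub> (p ^ k) = \<one>\<^bsub>G\<^esub>) \<longleftrightarrow> x [^]\<^bsub>G\<^esub> (p ^ a) = \<one>\<^bsub>G\<^esub>" if x: "x \<in> carrier G" for x
  proof
    assume "\<exists>k. x [^]\<^bsub>G\<^esub> (p ^ k) = \<one>\<^bsub>G\<^esub>"
    then obtain k where "ord x dvd p ^ k" using x pow_eq_id by blast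
    then obtain i where i: "ord x = p ^ i" using p by (auto simp: divides_primepow_nat)
    have "p ^ i dvd order G" using x i by (metis ord_dvd_group_order)
    then have "i \<le> a" unfolding a_def using oG p
      by (metis multiplicity_geI not_prime_unit)
    then show "x [^]\<^bsub>G\<^esub> (p ^ a) = \<one>\<^bsub>G\<^esub>" using x i by (simp add: pow_eq_id le_imp_power_dvd)
  qed blast
  then have "{x \<in> carrier (primary_component p G). x [^]\<^bsub>primary_component p G\<^esub> m = \<one>\<^bsub>primary_component p G\<^esub>}
      = {x \<in> carrier G. x [^]\<^bsub>G\<^esub> (gcd m (p ^ a)) = \<one>\<^bsub>G\<^esub>}"
    by (auto simp: primary_component_def pow_eq_id) blast
  then have "nsol (primary_component p G) m = nsol G (gcd m (p ^ a))" by (simp add: nsol_def)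
  also have "\<dots> = (\<Prod>q\<in>#M. gcd (gcd m (p ^ a)) q)" using M by (simp add: has_type_def)
  also have "\<dots> = (\<Prod>q\<in>#M. if p dvd q then gcd m q else 1)"
  proof (rule arg_cong[where f = prod_mset], rule image_mset_cong)
    fix q assume q: "q \<in># M"
    have pq: "primepow q" using q has_type_primepow[OF M] by blast
    show "gcd (gcd m (p ^ a)) q = (if p dvd q then gcd m q else 1)"
    proof (cases "p dvd q")
      case True
      have qe: "q = p ^ multiplicity p q" using p pq True by (rule prime_power_dvd_iff_eq)
      have "q dvd order G" using q has_type_order[OF M] by (simp add: dvd_prod_mset)
      then have "multiplicity p q \<le> a" unfolding a_def using oG by (intro dvd_imp_multiplicity_le)
      then have "q dvd p ^ a" using qe le_imp_power_dvd by metis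
      then have "gcd (p ^ a) q = q" by (simp add: gcd_nat.absorb2)
      with True show ?thesis by (simp add: gcd.assoc)
    next
      case False
      then have "coprime (p ^ a) q" using p by (simp add: prime_imp_coprime)
      then have "gcd (p ^ a) q = 1" by simp
      with False show ?thesis by (simp add: gcd.assoc)
    qed
  qed
  also have "\<dots> = (\<Prod>q\<in>#filter_mset (\<lambda>q. p dvd q) M. gcd m q)" by (induction M) auto
  finally show "nsol (primary_component p G) m = (\<Prod>q\<in>#filter_mset (\<lambda>q. p dvd q) M. gcd m q)" .
qed

lemma comm_group_primary_component:
  assumes "comm_group G" "finite (carrier G)"
  shows "comm_group (primary_component p G)" "finite (carrier (primary_component p G))"
  using comm_group.comm_group_subgroup[OF assms(1) subgroup_primary_component[OF assms(1)]] assms(2)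
  by (auto simp: primary_component_def)

lemma prod_lessThan_nth: "(\<Prod>i<length xs. f (xs ! i)) = prod_list (map f xs)"
  by (induction xs) (simp_all add: prod.lessThan_Suc_shift del: prod.lessThan_Suc)

lemma nsol_abelian_p_group_of_type:
  assumes "prime (p::nat)"
  shows "nsol (abelian_p_group_of_type p as) m = prod_list (map (\<lambda>a. gcd m (p ^ a)) as)"
  using assms prod_lessThan_nth[of "\<lambda>a. gcd m (p ^ a)" as]
  by (simp add: abelian_p_group_of_type_def nsol_product_group nsol_integer_mod_group prime_gt_0_nat)

lemma comm_group_abelian_p_group_of_type:
  assumes "prime (p::nat)"
  shows "comm_group (abelian_p_group_of_type p as)" "finite (carrier (abelian_p_group_of_type p as))"
  using assms
  by (auto simp: abelian_p_group_of_type_def carrier_integer_mod_group prime_gt_0_nat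
      intro!: comm_group_product_group finite_PiE)

lemma has_type_abelian_p_group_of_type:
  assumes "prime (p::nat)" "0 \<notin> set as"
  shows "has_type (abelian_p_group_of_type p as) (image_mset (\<lambda>a. p ^ a) (mset as))"
proof -
  have "primepow (p ^ a)" if "a \<in> set as" for a
    using that assms by (metis primepow_prime_power gr0I)
  then show ?thesis
    using nsol_abelian_p_group_of_type[OF assms(1), of as]
    by (auto simp: has_type_def prod_mset_prod_list[symmetric] image_mset.compositionality comp_def simp flip: mset_map prod_mset_prod_list)
qed

definition exponent_list :: "nat \<Rightarrow> nat multiset \<Rightarrow> nat list" where
  "exponent_list p M = sorted_list_of_multiset (image_mset (multiplicity p) (filter_mset (\<lambda>q. p dvd q) M))"

text \<open>The definite description is resolved by comparing types: an isomorphism fixes the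
  multiset of exponents, and sortedness then fixes the list.\<close>

lemma p_group_type_primary_component:
  assumes G: "comm_group G" "finite (carrier G)" and M: "has_type G M" and p: "prime (p::nat)"
  shows "p_group_type p (primary_component p G) = exponent_list p M"
  unfolding p_group_type_def
proof (rule the_equality)
  let ?N = "filter_mset (\<lambda>q. p dvd q) M"
  note P = comm_group_primary_component[OF G, of p] has_type_primary_component[OF G M p]
  have iso: "primary_component p G \<cong> abelian_p_group_of_type p as \<longleftrightarrow> ?N = image_mset (\<lambda>a. p ^ a) (mset as)"
    if "0 \<notin> set as" for as
    using iso_iff_has_type P comm_group_abelian_p_group_of_type[OF p] has_type_abelian_p_group_of_type[OF p that] by metis
  have N: "q = p ^ multiplicity p q" if "q \<in># ?N" for q
    using that p has_type_primepow[OF M] prime_power_dvd_iff_eq by auto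
  have 0: "0 \<notin> set (exponent_list p M)"
  proof
    assume "0 \<in> set (exponent_list p M)"
    then obtain q where "q \<in># ?N" "multiplicity p q = 0" by (auto simp: exponent_list_def)
    then show False using N[of q] p by (auto simp: not_prime_unit)
  qed
  have "image_mset (\<lambda>a. p ^ a) (mset (exponent_list p M)) = image_mset (\<lambda>q. q) ?N"
    unfolding exponent_list_def mset_sorted_list_of_multiset image_mset.compositionality comp_def
    using N by (intro image_mset_cong) simp
  then show "sorted (exponent_list p M) \<and> 0 \<notin> set (exponent_list p M) \<and>
      primary_component p G \<cong> abelian_p_group_of_type p (exponent_list p M)"
    using 0 iso[OF 0] by (simp add: exponent_list_def)
  fix as assume as: "sorted as \<and> 0 \<notin> set as \<and> primary_component p G \<cong> abelian_p_group_of_type p as"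
  then have "?N = image_mset (\<lambda>a. p ^ a) (mset as)" using iso by blast
  then have "image_mset (multiplicity p) ?N = image_mset (\<lambda>a. multiplicity p (p ^ a)) (mset as)"
    by (simp add: image_mset.compositionality comp_def)
  also have "\<dots> = mset as" using p by simp
  finally show "as = exponent_list p M"
    using as by (metis exponent_list_def sorted_list_of_multiset_mset sort_key_id_if_sorted sorted_sort_id)
qed

lemma fold_max_eq_Max: "fold max as (0::nat) = Max (insert 0 (set as))"
  by (metis Max.set_eq_fold list.simps(15))

text \<open>For j >= 1 this is the j-th part, in decreasing order, of the conjugate of the type of
  the p-primary component.\<close>

definition conj_part :: "nat \<Rightarrow> nat multiset \<Rightarrow> nat \<Rightarrow> nat" where
  "conj_part p M j = size (filter_mset (\<lambda>q. p ^ j dvd q) M)"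

text \<open>Also the number of parts of the conjugate at p; it is 0 if p divides no member.\<close>

definition max_exponent :: "nat \<Rightarrow> nat multiset \<Rightarrow> nat" where
  "max_exponent p M = Max (insert 0 (set (exponent_list p M)))"

text \<open>For j >= 1, divisibility by p^j entails divisibility by p, so the restriction to powers
  of p in \<open>exponent_list\<close> is absorbed. For j = 0 the powers of other primes would be
  counted too.\<close>

lemma length_filter_exponent_list:
  assumes p: "prime (p::nat)" and M: "\<forall>q\<in>#M. primepow q" and j: "1 \<le> j"
  shows "length (filter (\<lambda>a. j \<le> a) (exponent_list p M)) = conj_part p M j"
proof -
  have "p ^ j dvd q \<longleftrightarrow> p dvd q \<and> j \<le> multiplicity p q" if "q \<in># M" for q
  proof -
    have "p dvd p ^ j" using j by (simp add: dvd_power)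
    moreover have "q \<noteq> 0" using M that primepow_gt_0_nat by force
    ultimately show ?thesis using p by (metis dvd_trans power_dvd_iff_le_multiplicity not_prime_unit)
  qed
  then have "filter_mset (\<lambda>q. p ^ j dvd q) M = filter_mset (\<lambda>q. p dvd q \<and> j \<le> multiplicity p q) M"
    by (intro filter_mset_cong) auto
  moreover have "length (filter (\<lambda>a. j \<le> a) (exponent_list p M)) = size (filter_mset (\<lambda>a. j \<le> a) (mset (exponent_list p M)))"
    by (metis mset_filter size_mset)
  ultimately show ?thesis
    by (simp add: conj_part_def exponent_list_def filter_mset_image_mset filter_filter_mset conj_commute)
qed

lemma nsol_conj_p_group:
  assumes G: "comm_group G" "finite (carrier G)" and M: "has_type G M" and p: "prime (p::nat)"
  shows "nsol (conj_p_group p (primary_component p G)) m = (\<Prod>j=1..max_exponent p M. gcd m (p ^ conj_part p M j))"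
proof -
  have "nsol (conj_p_group p (primary_component p G)) m
    = prod_list (map (\<lambda>j. gcd m (p ^ length (filter (\<lambda>a. j \<le> a) (exponent_list p M)))) [1..<Suc (max_exponent p M)])"
    by (simp add: conj_p_group_def p_group_type_primary_component[OF G M p] nsol_abelian_p_group_of_type[OF p]
        conj_partition_def fold_max_eq_Max max_exponent_def rev_map[symmetric] prod_list.rev comp_def del: upt_Suc)
  also have "\<dots> = (\<Prod>j\<in>set [1..<Suc (max_exponent p M)]. gcd m (p ^ length (filter (\<lambda>a. j \<le> a) (exponent_list p M))))"
    by (subst prod.distinct_set_conv_list) (simp_all del: upt_Suc)
  also have "\<dots> = (\<Prod>j=1..max_exponent p M. gcd m (p ^ conj_part p M j))"
    using length_filter_exponent_list[OF p has_type_primepow[OF M]] by (intro prod.cong) auto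
  finally show ?thesis .
qed

section \<open>Merging coprime orders, and the rank of the conjugate\<close>

lemma gcd_mult_coprime:
  assumes "coprime (a::nat) b"
  shows "gcd m (a * b) = gcd m a * gcd m b"
proof (rule dvd_antisym)
  obtain x y where xy: "gcd m (a * b) = x * y" "x dvd a" "y dvd b"
    using division_decomp[of "gcd m (a * b)" a b] by auto
  then have "x dvd gcd m a" "y dvd gcd m b"
    by (metis dvd_mult_left dvd_mult_right gcd_dvd1 gcd_greatest)+
  then show "gcd m (a * b) dvd gcd m a * gcd m b" using xy by (simp add: mult_dvd_mono)
  have "coprime (gcd m a) (gcd m b)" using assms by (meson coprime_divisors gcd_dvd2)
  then show "gcd m a * gcd m b dvd gcd m (a * b)"
    by (intro gcd_greatest divides_mult) (auto intro: mult_dvd_mono)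
qed

text \<open>The Chinese remainder theorem on the level of counts: cyclic groups at distinct primes
  merge into one cyclic group.\<close>

lemma gcd_prod_prime_powers:
  assumes "finite P" "\<forall>p\<in>P. prime (p::nat)"
  shows "gcd m (\<Prod>p\<in>P. p ^ c p) = (\<Prod>p\<in>P. gcd m (p ^ c p))"
  using assms
proof (induction P rule: finite_induct)
  case (insert p P)
  have "coprime (p ^ c p) (\<Prod>q\<in>P. q ^ c q)"
    using insert by (intro prod_coprime_right) (auto intro: primes_coprime)
  then show ?case using insert by (simp add: gcd_mult_coprime)
qed simp

lemma multiplicity_in_exponent_list: "q \<in># M \<Longrightarrow> p dvd q \<Longrightarrow> multiplicity p q \<le> max_exponent p M"
  unfolding max_exponent_def by (intro Max_ge) (auto simp: exponent_list_def)

lemma max_exponent_ge: "prime (p::nat) \<Longrightarrow> p ^ k \<in># M \<Longrightarrow> k \<le> max_exponent p M"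
  using multiplicity_in_exponent_list[of "p ^ k" M p] by (cases k) (simp_all del: power_Suc add: dvd_power)

lemma max_exponent_attained:
  assumes "prime (p::nat)" "\<forall>q\<in>#M. primepow q" "max_exponent p M \<noteq> 0"
  shows "p ^ max_exponent p M \<in># M"
proof -
  have "max_exponent p M \<in> insert 0 (set (exponent_list p M))"
    unfolding max_exponent_def by (rule Max_in) auto
  then obtain q where q: "q \<in># M" "p dvd q" "max_exponent p M = multiplicity p q"
    using assms(3) by (auto simp: exponent_list_def)
  then show ?thesis using prime_power_dvd_iff_eq[OF assms(1), of q] assms(2) by simp
qed

lemma conj_part_eq_0:
  assumes p: "prime (p::nat)" and M: "\<forall>q\<in>#M. primepow q" and j: "max_exponent p M < j"
  shows "conj_part p M j = 0"
proof -
  have "\<not> p ^ j dvd q" if "q \<in># M" for q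
  proof
    assume d: "p ^ j dvd q"
    have "p dvd p ^ j" using j by (simp add: dvd_power)
    then have "multiplicity p q \<le> max_exponent p M" using multiplicity_in_exponent_list that d by (meson dvd_trans)
    moreover have "q \<noteq> 0" using M that primepow_gt_0_nat by force
    then have "j \<le> multiplicity p q" using d p by (metis multiplicity_geI not_prime_unit)
    ultimately show False using j by simp
  qed
  then have "filter_mset (\<lambda>q. p ^ j dvd q) M = {#}" by (simp add: filter_mset_eq_conv)
  then show ?thesis by (simp add: conj_part_def)
qed

lemma conj_part_pos:
  assumes p: "prime (p::nat)" and M: "\<forall>q\<in>#M. primepow q" and j: "1 \<le> j" "j \<le> max_exponent p M"
  shows "conj_part p M j > 0"
proof -
  have "p ^ max_exponent p M \<in># M" using p M j by (intro max_exponent_attained) auto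
  then have "p ^ max_exponent p M \<in># filter_mset (\<lambda>q. p ^ j dvd q) M" using j by (simp add: le_imp_power_dvd)
  then show ?thesis unfolding conj_part_def by (metis gr0I size_eq_0_iff_empty empty_not_add_mset multi_member_split)
qed

text \<open>At p the conjugate has \<open>max_exponent p M\<close> nontrivial cyclic factors, so x^p
  = 1 has at least p^(max_exponent) solutions, which bounds the rank from below. For the upper
  bound, the factors are regrouped by their index j across all primes.\<close>

theorem group_rank_conj_group_le_iff:
  assumes G: "comm_group G" "finite (carrier G)" and M: "has_type G M"
  shows "group_rank (conj_group G) \<le> r \<longleftrightarrow> (\<forall>p k. prime p \<longrightarrow> p ^ k \<in># M \<longrightarrow> k \<le> r)"
proof -
  interpret comm_group G by fact
  define P where "P = {p. prime p \<and> p dvd order G}"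
  have oG: "order G \<noteq> 0" using order_gt_0_iff_finite G by simp
  have P: "finite P" "\<forall>p\<in>P. prime p"
    using oG unfolding P_def by (auto intro: finite_subset[OF _ finite_divisors_nat[of "order G"]])
  note pp = has_type_primepow[OF M]
  let ?C = "conj_group G"
  have cC: "comm_group ?C"
    unfolding conj_group_def conj_p_group_def
    by (intro comm_group_product_group) (auto intro: comm_group_abelian_p_group_of_type)
  have fC: "finite (carrier ?C)"
    unfolding conj_group_def P_def[symmetric] carrier_product_group conj_p_group_def
    using P by (intro finite_PiE comm_group_abelian_p_group_of_type(2)) auto
  have nC: "nsol ?C m = (\<Prod>p\<in>P. \<Prod>j=1..max_exponent p M. gcd m (p ^ conj_part p M j))" for m
  proof -
    have "nsol ?C m = (\<Prod>p\<in>P. nsol (conj_p_group p (primary_component p G)) m)"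
      unfolding conj_group_def P_def[symmetric] using P
      by (intro nsol_product_group)
        (auto simp: conj_p_group_def intro: comm_group.axioms(2) comm_group_abelian_p_group_of_type)
    also have "\<dots> = (\<Prod>p\<in>P. \<Prod>j=1..max_exponent p M. gcd m (p ^ conj_part p M j))"
      using P by (intro prod.cong nsol_conj_p_group[OF G M]) auto
    finally show ?thesis .
  qed
  show ?thesis
  proof
    assume rk: "group_rank ?C \<le> r"
    show "\<forall>p k. prime p \<longrightarrow> p ^ k \<in># M \<longrightarrow> k \<le> r"
    proof (intro allI impI)
      fix p k :: nat assume p: "prime p" and k: "p ^ k \<in># M"
      have p1: "p > 1" using p by (rule prime_gt_1_nat)
      have "k \<noteq> 0" using k pp primepow_gt_Suc_0[of 1] by (metis One_nat_def less_irrefl power_0)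
      then have "p dvd p ^ k" by simp
      also have "p ^ k dvd order G" using k has_type_order[OF M] by (simp add: dvd_prod_mset)
      finally have pP: "p \<in> P" using p by (simp add: P_def)
      have "p ^ k \<le> p ^ max_exponent p M"
        using max_exponent_ge[OF p k] p1 by (simp add: power_increasing)
      also have "\<dots> = (\<Prod>j=1..max_exponent p M. gcd p (p ^ conj_part p M j))"
      proof -
        have "gcd p (p ^ conj_part p M j) = p" if "j \<in> {1..max_exponent p M}" for j
        proof -
          have "p dvd p ^ conj_part p M j" using conj_part_pos[OF p pp] that by (simp add: dvd_power)
          then show ?thesis by (simp add: gcd_nat.absorb1)
        qed
        then show ?thesis by simp
      qed
      also have "\<dots> \<le> nsol ?C p"
      proof -
        have "(\<Prod>j=1..max_exponent q M. gcd p (q ^ conj_part q M j)) \<ge> 1" for q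
          using p1 by (simp add: prod_ge_1 Suc_le_eq prod_pos)
        then show ?thesis unfolding nC prod.remove[OF P(1) pP]
          using prod_ge_1[of "P - {p}" "\<lambda>q. \<Prod>j=1..max_exponent q M. gcd p (q ^ conj_part q M j)"]
          by simp
      qed
      also have "\<dots> \<le> p ^ group_rank ?C"
        using comm_group.nsol_le_power_group_rank[OF cC fC] p1 by simp
      finally have "p ^ k \<le> p ^ group_rank ?C" .
      then have "k \<le> group_rank ?C" by (rule power_le_imp_le_exp[OF p1])
      then show "k \<le> r" using rk by simp
    qed
  next
    assume ex: "\<forall>p k. prime p \<longrightarrow> p ^ k \<in># M \<longrightarrow> k \<le> r"
    have le: "max_exponent p M \<le> r" if "prime p" for p
      using max_exponent_attained[OF that pp] ex that by (cases "max_exponent p M = 0") auto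
    \<comment> \<open>The order of the cyclic group formed by the parts with index i + 1 at all
      primes; parts are numbered from 1.\<close>
    define n where "n = (\<lambda>i. \<Prod>p\<in>P. p ^ conj_part p M (Suc i))"
    have "nsol ?C m = (\<Prod>i<r. gcd m (n i))" for m
    proof -
      \<comment> \<open>Each prime is padded to exactly r parts, so that the two products can be
        swapped. The added parts are 0 and contribute gcd m 1 = 1.\<close>
      have "nsol ?C m = (\<Prod>p\<in>P. \<Prod>j=1..r. gcd m (p ^ conj_part p M j))"
        unfolding nC
      proof (rule prod.cong[OF refl], rule prod.mono_neutral_left)
        fix p assume "p \<in> P"
        then have p: "prime p" using P by blast
        show "{1..max_exponent p M} \<subseteq> {1..r}" using le[OF p] by auto
        show "\<forall>i\<in>{1..r} - {1..max_exponent p M}. gcd m (p ^ conj_part p M i) = 1"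
          using conj_part_eq_0[OF p pp] by auto
      qed simp
      also have "\<dots> = (\<Prod>j=1..r. \<Prod>p\<in>P. gcd m (p ^ conj_part p M j))" by (rule prod.swap)
      also have "\<dots> = (\<Prod>j=1..r. gcd m (\<Prod>p\<in>P. p ^ conj_part p M j))"
        using gcd_prod_prime_powers[OF P] by simp
      also have "\<dots> = (\<Prod>i<r. gcd m (n i))" unfolding n_def by (simp add: prod.atLeast1_atMost_eq)
      finally show ?thesis .
    qed
    moreover have "n i > 0" for i using P by (auto simp: n_def prime_gt_0_nat intro!: prod_pos)
    ultimately show "group_rank ?C \<le> r" using group_rank_le_if_nsol[OF cC fC, of r n] by blast
  qed
qed

subsection \<open>Summation over types\<close>

text \<open>By \<open>group_rank_conj_group_le_iff\<close>, these are the types of the groups over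
  which the theorem sums.\<close>

definition bounded_types :: "nat \<Rightarrow> real \<Rightarrow> nat multiset set" where
  "bounded_types r x = {M. (\<forall>q\<in>#M. \<exists>p k. prime p \<and> 0 < k \<and> k \<le> r \<and> q = p ^ k) \<and> real (prod_mset M) \<le> x}"

definition type_sum :: "nat \<Rightarrow> real \<Rightarrow> real" where
  "type_sum r x = (\<Sum>M\<in>bounded_types r x. 2 ^ card (set_mset M))"

lemma prime_powers_eq:
  assumes "prime (p::nat)" "prime p'" "0 < k" "p ^ k = p' ^ k'"
  shows "p = p'" "k = k'"
proof -
  have "p dvd p' ^ k'" using assms(3,4) by (metis dvd_power)
  then show "p = p'" using assms(1,2) by (metis prime_dvd_power primes_dvd_imp_eq)
  then show "k = k'" using assms by (metis power_inject_exp prime_gt_1_nat)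
qed

lemma bounded_types_elem:
  assumes "M \<in> bounded_types r x" "q \<in># M"
  obtains p k where "prime p" "0 < k" "k \<le> r" "q = p ^ k"
  using assms unfolding bounded_types_def by blast

lemma bounded_types_pos: "M \<in> bounded_types r x \<Longrightarrow> q \<in># M \<Longrightarrow> q > 0"
  by (erule (1) bounded_types_elem) (simp add: prime_gt_0_nat)

text \<open>Base and exponent of a prime power are unique, so one representation with exponent at
  most r is the same as all representations having it.\<close>

lemma bounded_types_iff:
  "M \<in> bounded_types r x \<longleftrightarrow> (\<forall>q\<in>#M. primepow q) \<and> (\<forall>p k. prime p \<longrightarrow> p ^ k \<in># M \<longrightarrow> k \<le> r) \<and>
    real (prod_mset M) \<le> x"
proof -
  have *: "(\<exists>p k. prime p \<and> 0 < k \<and> k \<le> r \<and> q = p ^ k) \<longleftrightarrow>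
      primepow q \<and> (\<forall>p k. prime p \<longrightarrow> p ^ k = q \<longrightarrow> k \<le> r)" for q :: nat
  proof
    assume "\<exists>p k. prime p \<and> 0 < k \<and> k \<le> r \<and> q = p ^ k"
    then obtain p k where p: "prime p" "0 < k" "k \<le> r" "q = p ^ k" by blast
    have "k' \<le> r" if "prime p'" "p' ^ k' = q" for p' k'
      using prime_powers_eq(2)[of p p' k k'] p that by simp
    moreover have "primepow q" using p by (auto simp: primepow_def)
    ultimately show "primepow q \<and> (\<forall>p k. prime p \<longrightarrow> p ^ k = q \<longrightarrow> k \<le> r)" by blast
  next
    assume "primepow q \<and> (\<forall>p k. prime p \<longrightarrow> p ^ k = q \<longrightarrow> k \<le> r)"
    then show "\<exists>p k. prime p \<and> 0 < k \<and> k \<le> r \<and> q = p ^ k" by (auto simp: primepow_def)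
  qed
  show ?thesis unfolding bounded_types_def mem_Collect_eq * by blast
qed

text \<open>\<open>rep C\<close> is an unspecified member of the class, but every quantity in the
  sum depends only on the type, which all members share. Types and classes correspond via
  \<open>group_of_type\<close>.\<close>

lemma sum_num_unitary_factors_eq_type_sum:
  "(\<Sum>C | C \<in> iso_classes \<and> real (order (rep C)) \<le> x \<and> group_rank (conj_group (rep C)) \<le> r.
     real (num_unitary_factors (rep C))) = type_sum r x"
proof -
  let ?f = "\<lambda>M. iso_rel `` {group_of_type M}"
  let ?C = "{C. C \<in> iso_classes \<and> real (order (rep C)) \<le> x \<and> group_rank (conj_group (rep C)) \<le> r}"
  have rep: "rep C \<in> fin_ab_groups" "has_type (rep C) M"
    if "C = iso_rel `` {G}" "G \<in> fin_ab_groups" "has_type G M" for C G M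
  proof -
    have "C \<in> iso_classes" using that by (auto simp: iso_classes_def intro: quotientI)
    then have "(G, rep C) \<in> iso_rel" using rep_in_class that by blast
    then have "rep C \<in> fin_ab_groups" "G \<cong> rep C" by (auto simp: iso_rel_def)
    then show "rep C \<in> fin_ab_groups" "has_type (rep C) M"
      using that has_type_iso fin_ab_groupsD by blast+
  qed
  have cond: "real (order G) \<le> x \<and> group_rank (conj_group G) \<le> r \<longleftrightarrow> M \<in> bounded_types r x"
    if "G \<in> fin_ab_groups" "has_type G M" for G M
    using group_rank_conj_group_le_iff[OF fin_ab_groupsD(1,3)[OF that(1)] that(2)]
      has_type_primepow[OF that(2)] has_type_order[OF that(2)] by (auto simp: bounded_types_iff)
  have gt: "group_of_type M \<in> fin_ab_groups" "has_type (group_of_type M) M" if "M \<in> bounded_types r x" for M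
    using that by (auto simp: bounded_types_iff intro: group_of_type)
  have "?C = ?f ` bounded_types r x"
  proof (intro equalityI subsetI)
    fix C assume C: "C \<in> ?C"
    then obtain G where G: "C = iso_rel `` {G}" "G \<in> fin_ab_groups" by (auto simp: iso_classes_def elim: quotientE)
    obtain M where M: "has_type G M" using fin_ab_groups_has_type G by blast
    have bM: "M \<in> bounded_types r x" using cond[OF rep[OF G M]] C by blast
    then have "C = ?f M" using iso_rel_class_eq_iff G M gt by blast
    with bM show "C \<in> ?f ` bounded_types r x" by blast
  next
    fix C assume "C \<in> ?f ` bounded_types r x"
    then obtain M where M: "M \<in> bounded_types r x" "C = ?f M" by blast
    have "C \<in> iso_classes" using gt[OF M(1)] M(2) by (auto simp: iso_classes_def intro: quotientI)
    then show "C \<in> ?C" using cond[OF rep[OF M(2) gt[OF M(1)]]] M(1) by blast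
  qed
  moreover have "inj_on ?f (bounded_types r x)"
    by (rule inj_onI) (use iso_rel_class_eq_iff gt in blast)
  moreover have "real (num_unitary_factors (rep (?f M))) = 2 ^ card (set_mset M)" if "M \<in> bounded_types r x" for M
    using num_unitary_factors_eq[OF rep[OF refl gt[OF that]]] by simp
  ultimately show ?thesis unfolding type_sum_def by (simp add: sum.reindex)
qed

text \<open>Encodes a multiset of k-th powers of primes by the single number n whose prime
  factorization consists of their bases; its product is then n^k.\<close>

definition prime_powers_of :: "nat \<Rightarrow> nat \<Rightarrow> nat multiset" where
  "prime_powers_of k n = image_mset (\<lambda>p. p ^ k) (prime_factorization n)"

lemma prod_mset_prime_powers_of: "n > 0 \<Longrightarrow> prod_mset (prime_powers_of k n) = n ^ k"
proof -
  have "prod_mset (image_mset (\<lambda>p. p ^ k) N) = prod_mset N ^ k" for N :: "nat multiset"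
    by (induction N) (auto simp: power_mult_distrib)
  then show "n > 0 \<Longrightarrow> prod_mset (prime_powers_of k n) = n ^ k"
    by (simp add: prime_powers_of_def prod_mset_prime_factorization_nat)
qed

lemma prod_mset_pos_nat: "(\<And>q. q \<in># M \<Longrightarrow> q > 0) \<Longrightarrow> prod_mset M > (0::nat)"
  by (induction M) auto

text \<open>n is the product of the primes p for which p^(r+1) is a member of M, with multiplicity;
  the other members have exponent at most r.\<close>

lemma bounded_types_Suc:
  "bounded_types (Suc r) x
    = (\<lambda>(n, M). prime_powers_of (Suc r) n + M) ` (SIGMA n:{1..nat \<lfloor>x\<rfloor>}. bounded_types r (x / real n ^ Suc r))"
proof (intro equalityI subsetI)
  fix M assume M: "M \<in> bounded_types (Suc r) x"
  define Q where "Q = (\<lambda>q::nat. \<exists>p. prime p \<and> q = p ^ Suc r)"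
  define root where "root = (\<lambda>q::nat. SOME p. prime p \<and> q = p ^ Suc r)"
  have root: "prime (root q)" "q = root q ^ Suc r" if "Q q" for q
    using someI_ex[of "\<lambda>p. prime p \<and> q = p ^ Suc r"] that by (auto simp: Q_def root_def)
  define R where "R = image_mset root (filter_mset Q M)"
  define n where "n = prod_mset R"
  have "\<forall>p\<in>#R. prime p" using root by (auto simp: R_def)
  then have pf: "prime_factorization n = R" and n: "n > 0"
    unfolding n_def by (auto simp: prime_factorization_prod_mset_primes prime_gt_0_nat intro!: prod_mset_pos_nat)
  have "image_mset (\<lambda>p. p ^ Suc r) R = image_mset (\<lambda>q. q) (filter_mset Q M)"
    unfolding R_def image_mset.compositionality comp_def using root(2) by (intro image_mset_cong) simp
  then have N: "prime_powers_of (Suc r) n = filter_mset Q M" by (simp add: prime_powers_of_def pf)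
  define M' where "M' = filter_mset (\<lambda>q. \<not> Q q) M"
  have MM': "M = prime_powers_of (Suc r) n + M'" by (simp add: N M'_def)
  then have prod: "prod_mset M = n ^ Suc r * prod_mset M'" using prod_mset_prime_powers_of[OF n] by simp
  have le: "real (n ^ Suc r * prod_mset M') \<le> x" using M prod by (simp add: bounded_types_def)
  have "prod_mset M' > 0"
    using bounded_types_pos[OF M] by (intro prod_mset_pos_nat) (simp add: M'_def)
  \<comment> \<open>The index range is large enough, as n <= n^(r+1) <= x.\<close>
  then have "n * 1 \<le> n ^ Suc r * prod_mset M'" using n by (intro mult_le_mono) (auto simp: Suc_le_eq)
  then have "real n \<le> x" using le by linarith
  then have "n \<in> {1..nat \<lfloor>x\<rfloor>}" using n by (auto simp: le_nat_floor)
  moreover have "M' \<in> bounded_types r (x / real n ^ Suc r)"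
  proof -
    have "real (prod_mset M') \<le> x / real n ^ Suc r" using le n by (simp add: field_simps del: power_Suc)
    moreover have "\<exists>p k. prime p \<and> 0 < k \<and> k \<le> r \<and> q = p ^ k" if "q \<in># M'" for q
    proof -
      have "q \<in># M" "\<not> Q q" using that by (auto simp: M'_def)
      then obtain p k where "prime p" "0 < k" "k \<le> Suc r" "q = p ^ k" using M by (auto simp: bounded_types_def)
      moreover have "k \<noteq> Suc r" using calculation \<open>\<not> Q q\<close> by (auto simp: Q_def)
      ultimately show ?thesis by (metis le_SucE)
    qed
    ultimately show ?thesis by (auto simp: bounded_types_def)
  qed
  ultimately show "M \<in> (\<lambda>(n, M). prime_powers_of (Suc r) n + M) ` (SIGMA n:{1..nat \<lfloor>x\<rfloor>}. bounded_types r (x / real n ^ Suc r))"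
    using MM' by (intro image_eqI[of _ _ "(n, M')"]) auto
next
  fix M assume "M \<in> (\<lambda>(n, M). prime_powers_of (Suc r) n + M) ` (SIGMA n:{1..nat \<lfloor>x\<rfloor>}. bounded_types r (x / real n ^ Suc r))"
  then obtain n M' where n: "n \<in> {1..nat \<lfloor>x\<rfloor>}" and M': "M' \<in> bounded_types r (x / real n ^ Suc r)"
    and M: "M = prime_powers_of (Suc r) n + M'" by auto
  have "real (prod_mset M) = real n ^ Suc r * real (prod_mset M')"
    using n by (simp add: M prod_mset_prime_powers_of del: power_Suc)
  also have "\<dots> \<le> x" using M' n by (simp add: bounded_types_def field_simps del: power_Suc)
  finally have "real (prod_mset M) \<le> x" .
  moreover have "\<exists>p k. prime p \<and> 0 < k \<and> k \<le> Suc r \<and> q = p ^ k" if "q \<in># M" for q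
  proof -
    have "q \<in># prime_powers_of (Suc r) n \<or> q \<in># M'" using that M by auto
    then show ?thesis
    proof
      assume "q \<in># prime_powers_of (Suc r) n"
      then obtain p where "prime p" "q = p ^ Suc r" by (auto simp: prime_powers_of_def in_prime_factors_iff simp del: power_Suc)
      then show ?thesis by blast
    next
      assume "q \<in># M'"
      then obtain p k where "prime p" "0 < k" "k \<le> r" "q = p ^ k" by (rule bounded_types_elem[OF M'])
      then show ?thesis by (intro exI[of _ p] exI[of _ k]) simp
    qed
  qed
  ultimately show "M \<in> bounded_types (Suc r) x" by (simp add: bounded_types_def)
qed

text \<open>Makes the number of distinct members additive, which yields the weight 2^omega(n) in
  \<open>type_sum_Suc\<close>.\<close>

lemma prime_powers_of_disjoint:
  assumes "M \<in> bounded_types r y"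
  shows "set_mset (prime_powers_of (Suc r) n) \<inter> set_mset M = {}"
proof -
  have False if q: "q \<in># prime_powers_of (Suc r) n" "q \<in># M" for q
  proof -
    obtain p where p: "prime p" "q = p ^ Suc r"
      using q(1) by (auto simp: prime_powers_of_def in_prime_factors_iff simp del: power_Suc)
    obtain p' k where "prime p'" "0 < k" "k \<le> r" "q = p' ^ k" using bounded_types_elem[OF assms q(2)] by blast
    then show False using prime_powers_eq(2)[of p' p k "Suc r"] p by simp
  qed
  then show ?thesis by blast
qed

text \<open>The exponent r + 1 marks the first summand: filtering by it recovers
  \<open>prime_powers_of (Suc r) n\<close>, whose product n^(r+1) determines n.\<close>

lemma inj_on_prime_powers_plus:
  "inj_on (\<lambda>(n, M). prime_powers_of (Suc r) n + M) (SIGMA n:{1..nat \<lfloor>x\<rfloor>}. bounded_types r (x / real n ^ Suc r))"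
proof (rule inj_onI, clarify)
  fix n M n' M'
  assume n: "n \<in> {1..nat \<lfloor>x\<rfloor>}" "n' \<in> {1..nat \<lfloor>x\<rfloor>}"
    and M: "M \<in> bounded_types r (x / real n ^ Suc r)" "M' \<in> bounded_types r (x / real n' ^ Suc r)"
    and eq: "prime_powers_of (Suc r) n + M = prime_powers_of (Suc r) n' + M'"
  define Q where "Q = (\<lambda>q::nat. \<exists>p. prime p \<and> q = p ^ Suc r)"
  have Q: "filter_mset Q (prime_powers_of (Suc r) m) = prime_powers_of (Suc r) m" for m
    by (auto simp: filter_mset_eq_conv Q_def prime_powers_of_def in_prime_factors_iff simp del: power_Suc)
  have notQ: "filter_mset Q N = {#}" if N: "N \<in> bounded_types r y" for N y
  proof -
    have "\<not> Q q" if qN: "q \<in># N" for q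
    proof
      assume "Q q"
      then obtain p where p: "prime p" "q = p ^ Suc r" by (auto simp: Q_def)
      obtain p' k where "prime p'" "0 < k" "k \<le> r" "q = p' ^ k" using bounded_types_elem[OF N qN] by blast
      then show False using prime_powers_eq(2)[of p' p k "Suc r"] p by simp
    qed
    then show ?thesis by (auto simp: filter_mset_eq_conv)
  qed
  have "filter_mset Q (prime_powers_of (Suc r) n + M) = filter_mset Q (prime_powers_of (Suc r) n' + M')" using eq by simp
  then have pn: "prime_powers_of (Suc r) n = prime_powers_of (Suc r) n'" using notQ M by (simp add: Q)
  then have "n ^ Suc r = n' ^ Suc r" using prod_mset_prime_powers_of[of n "Suc r"] prod_mset_prime_powers_of[of n' "Suc r"] n
    by (simp del: power_Suc)
  then have "n = n'" by (metis power_inject_base zero_le)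
  then show "n = n' \<and> M = M'" using eq pn by simp
qed

lemma bounded_types_0: "bounded_types 0 x = (if x \<ge> 1 then {{#}} else {})"
proof -
  have "(\<forall>q\<in>#M. \<exists>p k. prime p \<and> 0 < k \<and> k \<le> 0 \<and> q = p ^ k) \<longleftrightarrow> M = {#}" for M :: "nat multiset"
    by (cases M) auto
  then show ?thesis unfolding bounded_types_def by auto
qed

lemma finite_bounded_types: "finite (bounded_types r x)"
  by (induction r arbitrary: x) (auto simp: bounded_types_0 bounded_types_Suc simp del: power_Suc)

lemma type_sum_0: "type_sum 0 x = (if x \<ge> 1 then 1 else 0)"
  by (simp add: type_sum_def bounded_types_0)

lemma type_sum_Suc:
  "type_sum (Suc r) x = (\<Sum>n=1..nat \<lfloor>x\<rfloor>. 2 ^ card (prime_factors n) * type_sum r (x / real n ^ Suc r))"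
proof -
  let ?S = "SIGMA n:{1..nat \<lfloor>x\<rfloor>}. bounded_types r (x / real n ^ Suc r)"
  have card: "card (set_mset (prime_powers_of (Suc r) n + M)) = card (prime_factors n) + card (set_mset M)"
    if "M \<in> bounded_types r y" for n M y
  proof -
    have "set_mset (prime_powers_of (Suc r) n) = (\<lambda>p. p ^ Suc r) ` prime_factors n"
      by (simp add: prime_powers_of_def)
    moreover have "inj_on (\<lambda>p::nat. p ^ Suc r) (prime_factors n)"
      by (intro inj_onI) (metis power_inject_base zero_le)
    ultimately have "card (set_mset (prime_powers_of (Suc r) n)) = card (prime_factors n)" by (simp add: card_image)
    then show ?thesis using prime_powers_of_disjoint[OF that, of n] by (simp add: card_Un_disjoint)
  qed
  have "type_sum (Suc r) x = (\<Sum>(n, M)\<in>?S. 2 ^ card (set_mset (prime_powers_of (Suc r) n + M)))"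
    unfolding type_sum_def bounded_types_Suc sum.reindex[OF inj_on_prime_powers_plus] by (simp add: case_prod_unfold)
  also have "\<dots> = (\<Sum>n=1..nat \<lfloor>x\<rfloor>. \<Sum>M\<in>bounded_types r (x / real n ^ Suc r). 2 ^ card (set_mset (prime_powers_of (Suc r) n + M)))"
    by (rule sum.Sigma[symmetric]) (auto simp: finite_bounded_types)
  also have "\<dots> = (\<Sum>n=1..nat \<lfloor>x\<rfloor>. 2 ^ card (prime_factors n) * type_sum r (x / real n ^ Suc r))"
    unfolding type_sum_def sum_distrib_left by (intro sum.cong refl) (simp add: card power_add del: set_mset_union)
  finally show ?thesis .
qed

subsection \<open>Coprime factorizations and divisor sums\<close>

definition moebius :: "nat \<Rightarrow> real" where
  "moebius n = (if squarefree n then (-1) ^ card (prime_factors n) else 0)"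

lemma abs_moebius_le: "\<bar>moebius n\<bar> \<le> 1"
  by (simp add: moebius_def)

lemma squarefree_divisors_eq:
  assumes "n > (0::nat)"
  shows "{d. d dvd n \<and> squarefree d} = Prod ` Pow (prime_factors n)"
    and "\<And>S. S \<subseteq> prime_factors n \<Longrightarrow> prime_factors (\<Prod>S) = S"
proof -
  have pf: "prime_factorization (\<Prod>S) = mset_set S" "finite S" if "S \<subseteq> prime_factors n" for S
  proof -
    show fin: "finite S" using that finite_subset by blast
    have "\<Prod>S = prod_mset (mset_set S)" by (simp add: prod_unfold_prod_mset)
    then show "prime_factorization (\<Prod>S) = mset_set S"
      using that fin by (auto intro!: prime_factorization_prod_mset_primes)
  qed
  then show "\<And>S. S \<subseteq> prime_factors n \<Longrightarrow> prime_factors (\<Prod>S) = S" by simp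
  show "{d. d dvd n \<and> squarefree d} = Prod ` Pow (prime_factors n)"
  proof (intro equalityI subsetI)
    fix d assume "d \<in> {d. d dvd n \<and> squarefree d}"
    then have d: "d dvd n" "squarefree d" by auto
    then have d0: "d \<noteq> 0" using assms by auto
    have "prime_factorization d = mset_set (prime_factors d)"
    proof (rule multiset_eqI)
      fix p show "count (prime_factorization d) p = count (mset_set (prime_factors d)) p"
      proof (cases "p \<in> prime_factors d")
        case True
        then have "multiplicity p d = 1" using d(2) d0 by (simp add: squarefree_factorial_semiring')
        then show ?thesis
          using True in_prime_factors_imp_prime[OF True] by (simp add: count_prime_factorization_prime)
      next
        case False
        then show ?thesis by (metis count_eq_zero_iff finite_set_mset elem_mset_set)
      qed
    qed
    then have "\<Prod>(prime_factors d) = prod_mset (prime_factorization d)" by (simp add: prod_unfold_prod_mset)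
    also have "\<dots> = d" using d0 by (simp add: prod_mset_prime_factorization_nat)
    finally have "d = \<Prod>(prime_factors d)" by simp
    moreover have "prime_factors d \<subseteq> prime_factors n" using d assms by (simp add: dvd_prime_factors)
    ultimately show "d \<in> Prod ` Pow (prime_factors n)" by blast
  next
    fix d assume "d \<in> Prod ` Pow (prime_factors n)"
    then obtain S where S: "S \<subseteq> prime_factors n" "d = \<Prod>S" by blast
    have d0: "d \<noteq> 0" using S pf(2)[OF S(1)] by (auto simp: prime_gt_0_nat)
    have "mset_set S \<subseteq># prime_factorization n"
    proof (rule mset_subset_eqI)
      fix p show "count (mset_set S) p \<le> count (prime_factorization n) p"
        using S(1) pf(2)[OF S(1)] by (cases "p \<in> S") (auto simp: Suc_le_eq)
    qed
    then have "d dvd n" using S pf[OF S(1)] d0 assms by (simp add: prime_factorization_subset_iff_dvd[symmetric])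
    moreover have "squarefree d"
      unfolding squarefree_factorial_semiring'[OF d0]
    proof
      fix p assume p: "p \<in> prime_factors d"
      then have "multiplicity p d = count (prime_factorization d) p"
        by (simp add: count_prime_factorization_prime in_prime_factors_imp_prime)
      also have "\<dots> = 1" using p S(2) pf[OF S(1)] by simp
      finally show "multiplicity p d = 1" .
    qed
    ultimately show "d \<in> {d. d dvd n \<and> squarefree d}" by blast
  qed
qed

text \<open>Squarefree divisors are the products of subsets of the prime factors, so the sum is the
  expansion of the product of (-1 + 1) over the primes dividing n.\<close>

lemma sum_moebius_divisors:
  assumes "n > 0"
  shows "(\<Sum>d | d dvd n. moebius d) = (if n = 1 then 1 else 0)"
proof -
  have "(\<Sum>d | d dvd n. moebius d) = (\<Sum>d | d dvd n \<and> squarefree d. (-1) ^ card (prime_factors d))"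
    using assms by (intro sum.mono_neutral_cong_right) (auto simp: moebius_def)
  also have "\<dots> = (\<Sum>S\<in>Pow (prime_factors n). (-1) ^ card S)"
    unfolding squarefree_divisors_eq(1)[OF assms]
  proof (subst sum.reindex)
    show "inj_on Prod (Pow (prime_factors n))"
      by (rule inj_onI) (metis PowD squarefree_divisors_eq(2)[OF assms])
  qed (auto intro!: sum.cong simp: squarefree_divisors_eq(2)[OF assms])
  also have "\<dots> = (\<Prod>p\<in>prime_factors n. -1 + 1)"
    by (subst prod_add) auto
  also have "\<dots> = (if n = 1 then 1 else 0)"
  proof (cases "n = 1")
    case False
    then have "prime_factors n \<noteq> {}" using assms by (simp add: prime_factorization_empty_iff)
    then show ?thesis using False by (simp add: card_gt_0_iff zero_power)
  qed simp
  finally show ?thesis .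
qed

lemma coprime_iff_prime_factorization:
  assumes "a > 0" "b > (0::nat)"
  shows "coprime a b \<longleftrightarrow> prime_factorization a \<inter># prime_factorization b = {#}"
proof -
  have "prime_factorization a \<inter># prime_factorization b = prime_factorization (gcd a b)"
    using assms by (simp add: prime_factorization_gcd)
  then show ?thesis using assms by (simp add: prime_factorization_empty_iff coprime_iff_gcd_eq_1)
qed

text \<open>Coprime factorizations of n are the disjoint splittings of its prime factorization, so
  \<open>card_unitary_splittings\<close> applies.\<close>

lemma card_coprime_factorizations:
  assumes "n > (0::nat)"
  shows "card {(a, b). a * b = n \<and> coprime a b} = 2 ^ card (prime_factors n)"
proof -
  let ?S = "{A. \<exists>B. prime_factorization n = A + B \<and> A \<inter># B = {#}}"
  have pos: "a > 0" "b > 0" if "a * b = n" for a b using that assms by (auto intro: gr0I)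
  have "bij_betw (\<lambda>(a, b). prime_factorization a) {(a, b). a * b = n \<and> coprime a b} ?S"
  proof (rule bij_betw_imageI)
    show "inj_on (\<lambda>(a, b). prime_factorization a) {(a, b). a * b = n \<and> coprime a b}"
    proof (rule inj_onI, clarify)
      fix a b a' b' assume *: "n = a * b" "a' * b' = a * b" "prime_factorization a = prime_factorization a'"
      have "a = a'" using * pos by (metis prod_mset_prime_factorization_nat)
      then show "a = a' \<and> b = b'" using * pos[of a b] by auto
    qed
    show "(\<lambda>(a, b). prime_factorization a) ` {(a, b). a * b = n \<and> coprime a b} = ?S"
    proof (intro equalityI subsetI)
      fix A assume "A \<in> (\<lambda>(a, b). prime_factorization a) ` {(a, b). a * b = n \<and> coprime a b}"
      then obtain a b where ab: "a * b = n" "coprime a b" "A = prime_factorization a" by auto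
      then have "prime_factorization n = A + prime_factorization b"
        using pos[of a b] by (auto simp: prime_factorization_mult)
      moreover have "A \<inter># prime_factorization b = {#}"
        using ab pos[of a b] coprime_iff_prime_factorization by blast
      ultimately show "A \<in> ?S" by blast
    next
      fix A assume "A \<in> ?S"
      then obtain B where B: "prime_factorization n = A + B" "A \<inter># B = {#}" by blast
      have pr: "prime p" if "p \<in># A \<or> p \<in># B" for p
        using B(1) that by (metis in_prime_factors_imp_prime union_iff)
      have pA: "prime_factorization (prod_mset A) = A" "prime_factorization (prod_mset B) = B"
        using pr by (auto intro: prime_factorization_prod_mset_primes)
      have AB: "prod_mset A * prod_mset B = n"
        using B(1) assms by (metis prod_mset_Un prod_mset_prime_factorization_nat)
      moreover have "coprime (prod_mset A) (prod_mset B)"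
        using coprime_iff_prime_factorization[OF pos[OF AB]] pA B(2) by simp
      ultimately show "A \<in> (\<lambda>(a, b). prime_factorization a) ` {(a, b). a * b = n \<and> coprime a b}"
        using pA by (intro image_eqI[of _ _ "(prod_mset A, prod_mset B)"]) auto
    qed
  qed
  then show ?thesis by (simp only: bij_betw_same_card card_unitary_splittings)
qed

section \<open>Lattice points under the hyperbola\<close>

definition hyperbola_pairs :: "real \<Rightarrow> (nat \<times> nat) set" where
  "hyperbola_pairs x = {(a, b). a > 0 \<and> b > 0 \<and> real (a * b) \<le> x}"

text \<open>The summatory function of the number of divisors.\<close>

definition divisor_sum :: "real \<Rightarrow> real" where
  "divisor_sum x = real (card (hyperbola_pairs x))"

lemma le_nat_floor_iff: "n > 0 \<Longrightarrow> n \<le> nat \<lfloor>x\<rfloor> \<longleftrightarrow> real n \<le> x"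
proof
  assume "n > 0" "n \<le> nat \<lfloor>x\<rfloor>"
  then have "int n \<le> \<lfloor>x\<rfloor>" by linarith
  then show "real n \<le> x" by (simp add: le_floor_iff)
qed (rule le_nat_floor)

lemma mult_le_real_iff_floor:
  assumes "a > 0" "b > 0"
  shows "real (a * b) \<le> x \<longleftrightarrow> b \<le> nat \<lfloor>x / real a\<rfloor>"
proof -
  have "real (a * b) \<le> x \<longleftrightarrow> real b \<le> x / real a" using assms by (simp add: field_simps)
  also have "\<dots> \<longleftrightarrow> b \<le> nat \<lfloor>x / real a\<rfloor>" using assms(2) by (rule le_nat_floor_iff[symmetric])
  finally show ?thesis .
qed

lemma hyperbola_pairs_eq: "hyperbola_pairs x = (SIGMA a:{1..nat \<lfloor>x\<rfloor>}. {1..nat \<lfloor>x / real a\<rfloor>})"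
proof -
  have "a \<le> nat \<lfloor>x\<rfloor>" if "a > 0" "b > 0" "real (a * b) \<le> x" for a b
  proof -
    have "real a * 1 \<le> real a * real b" using that by (intro mult_left_mono) auto
    then have "real a \<le> x" using that by (simp only: of_nat_mult)
    then show ?thesis by (rule le_nat_floor)
  qed
  then show ?thesis using mult_le_real_iff_floor by (fastforce simp: hyperbola_pairs_def Suc_le_eq)
qed

lemma finite_hyperbola_pairs: "finite (hyperbola_pairs x)"
  by (simp add: hyperbola_pairs_eq)

text \<open>\<open>type_sum 0\<close> is the indicator of x >= 1, so one step of the recursion
  leaves the sum of 2^omega(n), and each summand counts the coprime factorizations of n.\<close>

lemma type_sum_1_eq: "type_sum 1 x = real (card {(a, b) \<in> hyperbola_pairs x. coprime a b})"
proof -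
  let ?A = "\<lambda>n. {(a, b). a * b = n \<and> coprime a b}"
  have "type_sum 1 x = (\<Sum>n=1..nat \<lfloor>x\<rfloor>. 2 ^ card (prime_factors n) * type_sum 0 (x / real n))"
    using type_sum_Suc[of 0 x] by simp
  also have "\<dots> = (\<Sum>n=1..nat \<lfloor>x\<rfloor>. real (card (?A n)))"
  proof (intro sum.cong refl)
    fix n assume n: "n \<in> {1..nat \<lfloor>x\<rfloor>}"
    then have "real n \<le> x" "n > 0" using le_nat_floor_iff[of n x] by auto
    then show "2 ^ card (prime_factors n) * type_sum 0 (x / real n) = real (card (?A n))"
      by (simp add: type_sum_0 card_coprime_factorizations)
  qed
  also have "\<dots> = real (card (\<Union>n\<in>{1..nat \<lfloor>x\<rfloor>}. ?A n))"
  proof (subst card_UN_disjoint)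
    show "\<forall>n\<in>{1..nat \<lfloor>x\<rfloor>}. finite (?A n)"
    proof
      fix n assume "n \<in> {1..nat \<lfloor>x\<rfloor>}"
      then have "card (?A n) > 0" by (simp add: card_coprime_factorizations)
      then show "finite (?A n)" by (rule card_ge_0_finite)
    qed
  qed auto
  also have "(\<Union>n\<in>{1..nat \<lfloor>x\<rfloor>}. ?A n) = {(a, b) \<in> hyperbola_pairs x. coprime a b}"
  proof -
    have "a * b \<in> {1..nat \<lfloor>x\<rfloor>} \<longleftrightarrow> a > 0 \<and> b > 0 \<and> real (a * b) \<le> x" for a b
      using le_nat_floor_iff[of "a * b" x] by (auto simp: Suc_le_eq)
    moreover have "(a, b) \<in> (\<Union>n\<in>{1..nat \<lfloor>x\<rfloor>}. ?A n) \<longleftrightarrow> a * b \<in> {1..nat \<lfloor>x\<rfloor>} \<and> coprime a b" for a b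
      by blast
    ultimately have *: "(a, b) \<in> (\<Union>n\<in>{1..nat \<lfloor>x\<rfloor>}. ?A n) \<longleftrightarrow> (a, b) \<in> {(a, b) \<in> hyperbola_pairs x. coprime a b}" for a b
      unfolding hyperbola_pairs_def by blast
    show ?thesis
      by (intro equalityI subrelI) (erule *[THEN iffD1] *[THEN iffD2])+
  qed
  finally show ?thesis .
qed

lemma card_hyperbola_pairs_multiples:
  assumes "g > 0"
  shows "card {(a, b) \<in> hyperbola_pairs x. g dvd a \<and> g dvd b} = card (hyperbola_pairs (x / real g ^ 2))"
proof -
  have "{(a, b) \<in> hyperbola_pairs x. g dvd a \<and> g dvd b} = (\<lambda>(a, b). (g * a, g * b)) ` hyperbola_pairs (x / real g ^ 2)"
  proof (intro equalityI subsetI)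
    fix z assume "z \<in> {(a, b) \<in> hyperbola_pairs x. g dvd a \<and> g dvd b}"
    then obtain a b where ab: "z = (g * a, g * b)" "(g * a, g * b) \<in> hyperbola_pairs x" by (auto elim!: dvdE)
    then have "(a, b) \<in> hyperbola_pairs (x / real g ^ 2)"
      using assms by (auto simp: hyperbola_pairs_def field_simps power2_eq_square)
    then show "z \<in> (\<lambda>(a, b). (g * a, g * b)) ` hyperbola_pairs (x / real g ^ 2)" using ab by force
  next
    fix z assume "z \<in> (\<lambda>(a, b). (g * a, g * b)) ` hyperbola_pairs (x / real g ^ 2)"
    then show "z \<in> {(a, b) \<in> hyperbola_pairs x. g dvd a \<and> g dvd b}"
      using assms by (auto simp: hyperbola_pairs_def field_simps power2_eq_square)
  qed
  moreover have "inj_on (\<lambda>(a, b). (g * a, g * b)) (hyperbola_pairs (x / real g ^ 2))"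
    using assms by (auto simp: inj_on_def)
  ultimately show ?thesis by (simp add: card_image)
qed

text \<open>Coprimality is detected by summing \<open>moebius\<close> over the common divisors g;
  dividing both coordinates by g then turns x into x / g^2.\<close>

lemma type_sum_1_moebius:
  "type_sum 1 x = (\<Sum>g=1..nat \<lfloor>x\<rfloor>. moebius g * divisor_sum (x / real g ^ 2))"
proof -
  let ?P = "hyperbola_pairs x" and ?G = "{1..nat \<lfloor>x\<rfloor>}"
  have cop: "(\<Sum>g\<in>?G. if g dvd a \<and> g dvd b then moebius g else 0) = (if coprime a b then 1 else 0)"
    if ab: "(a, b) \<in> ?P" for a b
  proof -
    have a: "a > 0" "a \<le> nat \<lfloor>x\<rfloor>" using ab by (auto simp: hyperbola_pairs_eq)
    have "{g. g dvd gcd a b} \<subseteq> ?G" using a by (fastforce dest: dvd_imp_le simp: Suc_le_eq intro: gr0I)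
    have "(\<Sum>g\<in>?G. if g dvd a \<and> g dvd b then moebius g else 0) = (\<Sum>g | g dvd gcd a b. moebius g)"
      using \<open>{g. g dvd gcd a b} \<subseteq> ?G\<close> by (intro sum.mono_neutral_cong_right) auto
    also have "\<dots> = (if coprime a b then 1 else 0)"
      using a by (subst sum_moebius_divisors) (auto simp: coprime_iff_gcd_eq_1)
    finally show ?thesis .
  qed
  have "type_sum 1 x = (\<Sum>(a, b)\<in>?P. if coprime a b then 1 else 0)"
    unfolding type_sum_1_eq using finite_hyperbola_pairs
    by (simp add: case_prod_unfold sum.If_cases Int_def conj_commute)
  also have "\<dots> = (\<Sum>(a, b)\<in>?P. \<Sum>g\<in>?G. if g dvd a \<and> g dvd b then moebius g else 0)"
    using cop by (intro sum.cong) auto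
  also have "\<dots> = (\<Sum>g\<in>?G. \<Sum>(a, b)\<in>?P. if g dvd a \<and> g dvd b then moebius g else 0)"
    unfolding case_prod_unfold by (rule sum.swap)
  also have "\<dots> = (\<Sum>g\<in>?G. moebius g * divisor_sum (x / real g ^ 2))"
  proof (intro sum.cong refl)
    fix g assume "g \<in> ?G"
    then have "g > 0" by simp
    have "(\<Sum>(a, b)\<in>?P. if g dvd a \<and> g dvd b then moebius g else 0)
      = moebius g * real (card {(a, b) \<in> ?P. g dvd a \<and> g dvd b})"
      using finite_hyperbola_pairs by (simp add: case_prod_unfold sum.If_cases Int_def conj_commute mult.commute)
    then show "(\<Sum>(a, b)\<in>?P. if g dvd a \<and> g dvd b then moebius g else 0) = moebius g * divisor_sum (x / real g ^ 2)"
      by (simp add: card_hyperbola_pairs_multiples[OF \<open>g > 0\<close>] divisor_sum_def)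
  qed
  finally show ?thesis .
qed

lemma divisor_sum_eq_0: "x < 1 \<Longrightarrow> divisor_sum x = 0"
  by (simp add: divisor_sum_def hyperbola_pairs_eq)

lemma divisor_sum_eq: "divisor_sum x = (\<Sum>a=1..nat \<lfloor>x\<rfloor>. real (nat \<lfloor>x / real a\<rfloor>))"
  by (simp add: divisor_sum_def hyperbola_pairs_eq)

text \<open>The induction step uses ln t <= t - 1 at t = n / (n + 1).\<close>

lemma harm_le_ln: "n > 0 \<Longrightarrow> harm n \<le> 1 + ln (real n)"
proof (induction n rule: nat_induct_non_zero)
  case (Suc n)
  have "1 / real (Suc n) \<le> ln (real (Suc n)) - ln (real n)"
  proof -
    have "ln (real n / real (Suc n)) \<le> real n / real (Suc n) - 1" using Suc by (intro ln_le_minus_one) simp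
    also have "\<dots> = - (1 / real (Suc n))" by (simp add: field_simps)
    finally show ?thesis using Suc by (simp add: ln_div)
  qed
  then show ?case using Suc by (simp add: harm_Suc inverse_eq_divide)
qed (simp add: harm_def)

text \<open>With n the floor of x, removing the floors from the sum of x / a costs at most n <= x,
  and the harmonic number lies between ln (n + 1) and 1 + ln n.\<close>

lemma divisor_sum_bounds:
  assumes "x \<ge> 1"
  shows "divisor_sum x \<le> x * (1 + ln x)" "x * ln x - x \<le> divisor_sum x"
proof -
  define n where "n = nat \<lfloor>x\<rfloor>"
  have n: "n > 0" "real n \<le> x" "x \<le> real n + 1" using assms unfolding n_def by linarith+
  have harm: "(\<Sum>a=1..n. x / real a) = x * harm n"
    by (simp only: harm_def sum_distrib_left divide_inverse)
  have "divisor_sum x \<le> (\<Sum>a=1..n. x / real a)"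
    unfolding divisor_sum_eq n_def[symmetric] using assms by (intro sum_mono) simp
  also have "\<dots> \<le> x * (1 + ln x)"
    unfolding harm using assms n harm_le_ln[OF n(1)]
    by (intro mult_left_mono) (auto intro: order_trans)
  finally show "divisor_sum x \<le> x * (1 + ln x)" .
  have "ln x \<le> ln (real n + 1)" using assms n by simp
  also have "\<dots> \<le> harm n" by (rule ln_le_harm)
  finally have "x * ln x - x \<le> x * harm n - real n" using assms n by (intro diff_mono mult_left_mono) auto
  also have "\<dots> = (\<Sum>a=1..n. x / real a - 1)" unfolding sum_subtractf harm by simp
  also have "\<dots> \<le> divisor_sum x"
    unfolding divisor_sum_eq n_def[symmetric] using assms by (intro sum_mono) linarith
  finally show "x * ln x - x \<le> divisor_sum x" .
qed

subsection \<open>Asymptotics\<close>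

text \<open>The limit alone would not survive infinite weighted sums. Vanishing below 1 turns finite
  sums into full series, and the global bound provides the majorant; it has 1 + ln x because ln x is
  0 at x = 1.\<close>

definition x_log_x_growth :: "(real \<Rightarrow> real) \<Rightarrow> real \<Rightarrow> bool" where
  "x_log_x_growth F K \<longleftrightarrow> (\<forall>x<1. F x = 0) \<and> (\<exists>C. \<forall>x\<ge>1. \<bar>F x\<bar> \<le> C * (x * (1 + ln x))) \<and>
     ((\<lambda>x. F x / (x * ln x)) \<longlongrightarrow> K) at_top"

lemma x_log_x_growth_divisor_sum: "x_log_x_growth divisor_sum 1"
  unfolding x_log_x_growth_def
proof (intro conjI allI impI exI)
  fix x :: real
  show "x < 1 \<Longrightarrow> divisor_sum x = 0" by (rule divisor_sum_eq_0)
  show "x \<ge> 1 \<Longrightarrow> \<bar>divisor_sum x\<bar> \<le> 1 * (x * (1 + ln x))"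
    using divisor_sum_bounds(1)[of x] by (simp add: divisor_sum_def)
next
  show "((\<lambda>x. divisor_sum x / (x * ln x)) \<longlongrightarrow> 1) at_top"
  proof (rule tendsto_sandwich)
    show "((\<lambda>x::real. (x * ln x - x) / (x * ln x)) \<longlongrightarrow> 1) at_top" by real_asymp
    show "((\<lambda>x::real. x * (1 + ln x) / (x * ln x)) \<longlongrightarrow> 1) at_top" by real_asymp
    show "\<forall>\<^sub>F x in at_top. (x * ln x - x) / (x * ln x) \<le> divisor_sum x / (x * ln x)"
      using eventually_gt_at_top[of 1]
    proof eventually_elim
      case (elim x)
      then show ?case by (intro divide_right_mono divisor_sum_bounds) auto
    qed
    show "\<forall>\<^sub>F x in at_top. divisor_sum x / (x * ln x) \<le> x * (1 + ln x) / (x * ln x)"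
      using eventually_gt_at_top[of 1]
    proof eventually_elim
      case (elim x)
      then show ?case by (intro divide_right_mono divisor_sum_bounds) auto
    qed
  qed
qed

text \<open>Each term, divided by x ln x, tends to K a(n) / n^k because ln (x / c) / ln x tends to
  1. The terms are dominated by a constant times |a(n)| / n^k, so Tannery's theorem exchanges limit
  and sum.\<close>

theorem x_log_x_growth_weighted_sum:
  fixes a :: "nat \<Rightarrow> real"
  assumes F: "x_log_x_growth F K" and k: "k \<ge> 1" and a: "summable (\<lambda>n. \<bar>a n\<bar> / real n ^ k)"
  shows "x_log_x_growth (\<lambda>x. \<Sum>n=1..nat \<lfloor>x\<rfloor>. a n * F (x / real n ^ k)) (K * (\<Sum>n. a n / real n ^ k))"
proof -
  have F0: "F x = 0" if "x < 1" for x using F that by (simp add: x_log_x_growth_def)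
  obtain C where C: "\<And>x. x \<ge> 1 \<Longrightarrow> \<bar>F x\<bar> \<le> C * (x * (1 + ln x))"
    using F by (auto simp: x_log_x_growth_def)
  \<comment> \<open>In the term n = 0 the argument x / 0^k is 0, where F vanishes; so the series may
    include n = 0.\<close>
  have zk: "(0::real) ^ k = 0" using k by (simp add: zero_power)
  have C0: "C \<ge> 0" using C[of 1] by simp
  have lim: "((\<lambda>x. F x / (x * ln x)) \<longlongrightarrow> K) at_top" using F by (simp add: x_log_x_growth_def)
  have term_le: "\<bar>a n * F (x / real n ^ k)\<bar> \<le> C * (x * (1 + ln x)) * (\<bar>a n\<bar> / real n ^ k)" if x: "x \<ge> 1" for n x
  proof (cases "x / real n ^ k \<ge> 1")
    case True
    then have n: "n > 0" using zk by (intro gr0I) auto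
    then have "1 \<le> real n ^ k" by simp
    then have le: "x / real n ^ k \<le> x" using x by (simp add: divide_le_eq mult_le_cancel_left1)
    then have "ln (x / real n ^ k) \<le> ln x" using True by (intro ln_mono) auto
    then have "x / real n ^ k * (1 + ln (x / real n ^ k)) \<le> x / real n ^ k * (1 + ln x)"
      using x by (intro mult_left_mono) auto
    then have "\<bar>F (x / real n ^ k)\<bar> \<le> C * (x / real n ^ k * (1 + ln x))"
      using C[OF True] C0 by (meson mult_left_mono order_trans)
    then have "\<bar>a n\<bar> * \<bar>F (x / real n ^ k)\<bar> \<le> \<bar>a n\<bar> * (C * (x / real n ^ k * (1 + ln x)))"
      by (intro mult_left_mono) auto
    then show ?thesis by (simp add: abs_mult mult_ac)
  next
    case False
    then show ?thesis using F0[of "x / real n ^ k"] C0 x by simp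
  qed
  \<comment> \<open>For n > x the argument x / n^k is below 1, so the terms beyond the range
    vanish.\<close>
  have series: "(\<Sum>n=1..nat \<lfloor>x\<rfloor>. a n * F (x / real n ^ k)) = (\<Sum>n. a n * F (x / real n ^ k))" if x: "x \<ge> 1" for x
  proof (rule suminf_finite[symmetric])
    fix n assume n: "n \<notin> {1..nat \<lfloor>x\<rfloor>}"
    have "x / real n ^ k < 1"
    proof (cases "n = 0")
      case True
      then show ?thesis using k by (simp add: zero_power)
    next
      case False
      then have "x < real n" using n le_nat_floor_iff[of n x] by auto
      also have "\<dots> \<le> real n ^ k" using False k by (intro self_le_power) auto
      finally show ?thesis using False by simp
    qed
    then show "a n * F (x / real n ^ k) = 0" using F0 by simp
  qed simp
  show ?thesis unfolding x_log_x_growth_def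
  proof (intro conjI allI impI)
    fix x :: real assume "x < 1"
    then show "(\<Sum>n=1..nat \<lfloor>x\<rfloor>. a n * F (x / real n ^ k)) = 0" by simp
  next
    show "\<exists>C. \<forall>x\<ge>1. \<bar>\<Sum>n=1..nat \<lfloor>x\<rfloor>. a n * F (x / real n ^ k)\<bar> \<le> C * (x * (1 + ln x))"
    proof (intro exI allI impI)
      fix x :: real assume x: "x \<ge> 1"
      have "\<bar>\<Sum>n=1..nat \<lfloor>x\<rfloor>. a n * F (x / real n ^ k)\<bar> \<le> (\<Sum>n=1..nat \<lfloor>x\<rfloor>. C * (x * (1 + ln x)) * (\<bar>a n\<bar> / real n ^ k))"
        by (rule order_trans[OF sum_abs sum_mono[OF term_le[OF x]]])
      also have "\<dots> = C * (x * (1 + ln x)) * (\<Sum>n=1..nat \<lfloor>x\<rfloor>. \<bar>a n\<bar> / real n ^ k)" by (rule sum_distrib_left[symmetric])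
      also have "\<dots> \<le> C * (x * (1 + ln x)) * (\<Sum>n. \<bar>a n\<bar> / real n ^ k)"
        using a C0 x by (intro mult_left_mono sum_le_suminf) auto
      finally show "\<bar>\<Sum>n=1..nat \<lfloor>x\<rfloor>. a n * F (x / real n ^ k)\<bar> \<le> C * (\<Sum>n. \<bar>a n\<bar> / real n ^ k) * (x * (1 + ln x))"
        by (simp add: mult_ac)
    qed
  next
    let ?b = "\<lambda>n x. a n * F (x / real n ^ k) / (x * ln x)"
    have limb: "(?b n \<longlongrightarrow> K * (a n / real n ^ k)) at_top" for n
    proof (cases "n = 0")
      case True
      then show ?thesis using k F0[of 0] by (simp add: zero_power)
    next
      case False
      define c where "c = real n ^ k"
      have c: "c > 0" using False by (simp add: c_def)
      have 1: "((\<lambda>x. F (x / c) / (x / c * ln (x / c))) \<longlongrightarrow> K) at_top"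
        by (rule filterlim_compose[OF lim]) (use c in real_asymp)
      have 2: "((\<lambda>x. ln (x / c) / ln x) \<longlongrightarrow> 1) at_top" using c by real_asymp
      have "((\<lambda>x. a n / c * (F (x / c) / (x / c * ln (x / c)) * (ln (x / c) / ln x))) \<longlongrightarrow> a n / c * (K * 1)) at_top"
        by (intro tendsto_intros 1 2)
      moreover have "\<forall>\<^sub>F x in at_top. a n / c * (F (x / c) / (x / c * ln (x / c)) * (ln (x / c) / ln x)) = ?b n x"
        using eventually_gt_at_top[of c] eventually_gt_at_top[of 1]
      proof eventually_elim
        case (elim x)
        then have "ln (x / c) \<noteq> 0" "ln x \<noteq> 0" using c by auto
        then show ?case using elim c by (simp add: c_def[symmetric] field_simps)
      qed
      ultimately show ?thesis by (simp add: c_def tendsto_cong mult.commute)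
    qed
    have bound: "\<forall>\<^sub>F (n, x) in at_top \<times>\<^sub>F at_top. norm (?b n x) \<le> 2 * C * (\<bar>a n\<bar> / real n ^ k)"
    proof -
      \<comment> \<open>From exp 1 on, ln x >= 1 and thus 1 + ln x <= 2 ln x; this is the origin of
        the factor 2.\<close>
      have "norm (?b n x) \<le> 2 * C * (\<bar>a n\<bar> / real n ^ k)" if x: "x \<ge> exp 1" for n x
      proof -
        have x1: "x \<ge> 1" using x exp_ge_add_one_self[of "1::real"] by linarith
        have ln: "ln x \<ge> 1" using x x1 by (simp add: ln_ge_iff)
        have "norm (?b n x) = \<bar>a n * F (x / real n ^ k)\<bar> / (x * ln x)" using x1 ln by (simp add: abs_mult)
        also have "\<dots> \<le> C * (x * (1 + ln x)) * (\<bar>a n\<bar> / real n ^ k) / (x * ln x)"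
          using term_le[OF x1] x1 ln by (intro divide_right_mono) auto
        also have "\<dots> \<le> C * (x * (2 * ln x)) * (\<bar>a n\<bar> / real n ^ k) / (x * ln x)"
          using x1 ln C0 by (intro divide_right_mono mult_right_mono mult_left_mono) auto
        also have "\<dots> = 2 * C * (\<bar>a n\<bar> / real n ^ k)"
        proof -
          have "C * (x * (2 * ln x)) * A / (x * ln x) = 2 * C * A" for A
          proof -
            have "x \<noteq> 0" "ln x \<noteq> 0" using x1 ln by linarith+
            then have nz: "x * ln x \<noteq> 0" by (rule no_zero_divisors)
            have "C * (x * (2 * ln x)) * A = 2 * C * A * (x * ln x)" by simp
            then show ?thesis using nonzero_mult_div_cancel_right[OF nz, of "2 * C * A"] by (simp only:)
          qed
          then show ?thesis .
        qed
        finally show ?thesis .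
      qed
      then show ?thesis
        unfolding eventually_prod_filter
        by (intro exI[of _ "\<lambda>_. True"] exI[of _ "\<lambda>x. x \<ge> exp 1"]) auto
    qed
    have "((\<lambda>x. \<Sum>n. ?b n x) \<longlongrightarrow> (\<Sum>n. K * (a n / real n ^ k))) at_top"
      using tannerys_theorem[OF limb bound summable_mult[OF a] trivial_limit_at_top_linorder] by blast
    moreover have "(\<Sum>n. K * (a n / real n ^ k)) = K * (\<Sum>n. a n / real n ^ k)"
    proof (rule suminf_mult)
      show "summable (\<lambda>n. a n / real n ^ k)" by (rule summable_rabs_cancel) (use a in \<open>simp add: abs_divide\<close>)
    qed
    moreover have "\<forall>\<^sub>F x in at_top. (\<Sum>n. ?b n x) = (\<Sum>n=1..nat \<lfloor>x\<rfloor>. a n * F (x / real n ^ k)) / (x * ln x)"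
      using eventually_ge_at_top[of 1]
    proof eventually_elim
      case (elim x)
      have "summable (\<lambda>n. C * (x * (1 + ln x)) * (\<bar>a n\<bar> / real n ^ k))" using a by (rule summable_mult)
      then have "summable (\<lambda>n. a n * F (x / real n ^ k))"
        by (rule summable_comparison_test'[of _ 0]) (use term_le[OF elim] in simp)
      then show ?case unfolding series[OF elim] by (rule suminf_divide)
    qed
    ultimately show "((\<lambda>x. (\<Sum>n=1..nat \<lfloor>x\<rfloor>. a n * F (x / real n ^ k)) / (x * ln x)) \<longlongrightarrow> K * (\<Sum>n. a n / real n ^ k)) at_top"
      by (simp add: tendsto_cong)
  qed
qed

text \<open>The constant is the sum of mu(g) / g^2. Only its sign matters, so its first terms are
  compared with a telescoping bound for the rest.\<close>

lemma type_sum_1_growth: "\<exists>K>0. x_log_x_growth (type_sum 1) K"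
proof -
  have sq: "summable (\<lambda>n. 1 / real n ^ 2)"
    using inverse_power_summable[of 2, where ?'a = real] by (simp add: inverse_eq_divide)
  have abs: "summable (\<lambda>n. \<bar>moebius n\<bar> / real n ^ 2)"
    by (rule summable_comparison_test'[OF sq, of 0]) (use abs_moebius_le in \<open>simp add: divide_right_mono\<close>)
  let ?S = "\<Sum>n. moebius n / real n ^ 2"
  have "type_sum 1 = (\<lambda>x. \<Sum>g=1..nat \<lfloor>x\<rfloor>. moebius g * divisor_sum (x / real g ^ 2))"
    by (rule ext) (rule type_sum_1_moebius)
  then have g: "x_log_x_growth (type_sum 1) (1 * ?S)"
    using x_log_x_growth_weighted_sum[OF x_log_x_growth_divisor_sum _ abs] by simp
  \<comment> \<open>The tail from \<open>n = 2\<close> on is at most the telescoping bound \<open>1/4 + (1/2 - 1/3) + (1/3 - 1/4) + \<dots> = 3/4\<close>.\<close>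
  have "\<bar>\<Sum>n. moebius (n + 3) / real (n + 3) ^ 2\<bar> \<le> 1 / 2"
  proof -
    have tel: "(\<lambda>n. 1 / real (n + 2) - 1 / real (Suc n + 2)) sums (1 / real (0 + 2) - 0)"
      by (rule telescope_sums') real_asymp
    have "norm (moebius (n + 3) / real (n + 3) ^ 2) \<le> 1 / real (n + 2) - 1 / real (Suc n + 2)" for n
    proof -
      have "norm (moebius (n + 3) / real (n + 3) ^ 2) \<le> 1 / real (n + 3) ^ 2"
        using abs_moebius_le[of "n + 3"] by (simp add: divide_right_mono)
      also have "\<dots> \<le> 1 / (real (n + 2) * real (n + 3))"
        by (intro divide_left_mono) (auto simp: power2_eq_square)
      also have "\<dots> = 1 / real (n + 2) - 1 / real (Suc n + 2)" by (simp add: field_simps)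
      finally show ?thesis .
    qed
    then show ?thesis
      using norm_suminf_le[OF _ sums_summable[OF tel], of "\<lambda>n. moebius (n + 3) / real (n + 3) ^ 2"]
        sums_unique[OF tel] by simp
  qed
  moreover have "?S = (\<Sum>n. moebius (n + 3) / real (n + 3) ^ 2) + (\<Sum>n<3. moebius n / real n ^ 2)"
    by (rule suminf_split_initial_segment, rule summable_rabs_cancel) (use abs in \<open>simp add: abs_divide\<close>)
  \<comment> \<open>The terms n = 0, 1, 2 are 0, 1 and at least -1/4.\<close>
  moreover have "(\<Sum>n<3. moebius n / real n ^ 2) \<ge> 3 / 4"
    using abs_moebius_le[of 2] by (simp add: eval_nat_numeral) (simp add: moebius_def)
  ultimately have "?S > 0" by linarith
  with g show ?thesis by auto
qed

text \<open>Of two complementary divisors d and n / d, one is at most the square root of n.\<close>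

lemma card_divisors_le: "n > 0 \<Longrightarrow> real (card {d. d dvd n}) \<le> 2 * sqrt (real n)"
proof -
  assume n: "n > (0::nat)"
  define m where "m = floor_sqrt n"
  have "{d. d dvd n} \<subseteq> {1..m} \<union> (\<lambda>d. n div d) ` {1..m}"
  proof
    fix d assume "d \<in> {d. d dvd n}"
    then obtain e where e: "n = d * e" by blast
    then have de: "d > 0" "e > 0" using n by (auto intro: gr0I)
    show "d \<in> {1..m} \<union> (\<lambda>d. n div d) ` {1..m}"
    proof (cases "d \<le> m")
      case False
      have "e \<le> m"
      proof (rule ccontr)
        assume "\<not> e \<le> m"
        then have "Suc m * Suc m \<le> d * e" using False by (intro mult_le_mono) auto
        then show False using Suc_floor_sqrt_power2_gt[of n] e by (simp add: m_def power2_eq_square)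
      qed
      then show ?thesis using e de by (intro UnI2 image_eqI[of _ _ e]) auto
    qed (use de in auto)
  qed
  then have "card {d. d dvd n} \<le> card ({1..m} \<union> (\<lambda>d. n div d) ` {1..m})" by (intro card_mono) auto
  also have "\<dots> \<le> m + m" using card_Un_le card_image_le[of "{1..m}" "\<lambda>d. n div d"]
    by (metis add_left_mono card_atLeastAtMost diff_Suc_1 finite_atLeastAtMost order_trans)
  finally have "card {d. d dvd n} \<le> 2 * m" by simp
  moreover have "real m \<le> sqrt (real n)"
    unfolding m_def by (rule real_le_rsqrt) (metis floor_sqrt_power2_le of_nat_le_iff of_nat_power)
  ultimately show ?thesis by linarith
qed

text \<open>A coprime factorization is determined by its first factor, so there are no more of them
  than divisors.\<close>

lemma power_card_prime_factors_le: "n > 0 \<Longrightarrow> 2 ^ card (prime_factors n) \<le> 2 * sqrt (real n)"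
proof -
  assume n: "n > 0"
  have "inj_on fst {(a, b). a * b = n \<and> coprime a b}" using n by (auto simp: inj_on_def)
  then have "card {(a, b). a * b = n \<and> coprime a b} \<le> card {d. d dvd n}"
    using n by (intro card_inj_on_le[of fst]) auto
  then have "real (2 ^ card (prime_factors n)) \<le> real (card {d. d dvd n})"
    unfolding card_coprime_factorizations[OF n] by (rule of_nat_mono)
  also have "\<dots> \<le> 2 * sqrt (real n)" by (rule card_divisors_le[OF n])
  finally show ?thesis by (simp only: of_nat_power of_nat_numeral)
qed

text \<open>The square-root bound leaves n^(-3/2) already for k = 2.\<close>

lemma summable_power_card_prime_factors:
  assumes "k \<ge> 2"
  shows "summable (\<lambda>n. 2 ^ card (prime_factors n) / real n ^ k)"
proof (rule summable_comparison_test')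
  show "summable (\<lambda>n. 2 * real n powr (-3/2))" by (intro summable_mult) (simp add: summable_real_powr_iff)
  fix n :: nat assume n: "n \<ge> 1"
  have "2 ^ card (prime_factors n) / real n ^ k \<le> 2 * sqrt (real n) / real n ^ 2"
    using n assms power_card_prime_factors_le[of n] by (intro frac_le power_increasing) auto
  also have "\<dots> = 2 * (real n powr (1/2) / real n powr 2)" using n by (simp add: powr_half_sqrt powr_numeral)
  also have "real n powr (1/2) / real n powr 2 = real n powr (1/2 - 2)" by (rule powr_diff[symmetric])
  finally show "norm (2 ^ card (prime_factors n) / real n ^ k) \<le> 2 * real n powr (-3/2)" by simp
qed

theorem type_sum_growth:
  assumes "r \<ge> 1"
  shows "\<exists>K>0. x_log_x_growth (type_sum r) K"
  using assms
proof (induction r rule: dec_induct)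
  case base
  show ?case by (rule type_sum_1_growth)
next
  case (step r)
  then obtain K where K: "K > 0" "x_log_x_growth (type_sum r) K" by auto
  let ?a = "\<lambda>n. 2 ^ card (prime_factors n) :: real"
  have s: "summable (\<lambda>n. ?a n / real n ^ Suc r)" using step by (intro summable_power_card_prime_factors) simp
  have "x_log_x_growth (type_sum (Suc r)) (K * (\<Sum>n. ?a n / real n ^ Suc r))"
    using x_log_x_growth_weighted_sum[OF K(2), of "Suc r" ?a] s by (simp add: type_sum_Suc[abs_def] del: power_Suc)
  moreover have "(\<Sum>n. ?a n / real n ^ Suc r) > 0"
    \<comment> \<open>No term is negative, and the term n = 1 equals 1.\<close>
    by (rule suminf_pos2[OF s, of 1]) auto
  ultimately show ?case using K(1) by (intro exI conjI) auto
qed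

theorem corollary2:
  fixes r :: nat
  assumes "r \<ge> 1"
  shows "\<exists>K::real.
    (\<lambda>x::real. \<Sum>C | C \<in> iso_classes \<and> real (order (rep C)) \<le> x \<and>
                      group_rank (conj_group (rep C)) \<le> r.
                 real (num_unitary_factors (rep C)))
    \<sim>[at_top] (\<lambda>x. K * x * ln x)"
proof -
  \<comment> \<open>K > 0 allows the limit of \<open>type_sum r x / (x * ln x)\<close> to be
    normalised to 1.\<close>
  obtain K where K: "K > 0" "x_log_x_growth (type_sum r) K" using type_sum_growth[OF assms] by blast
  have "type_sum r \<sim>[at_top] (\<lambda>x. K * x * ln x)"
  proof (rule asymp_equivI')
    have "((\<lambda>x. type_sum r x / (x * ln x) / K) \<longlongrightarrow> K / K) at_top"
      using K by (intro tendsto_divide tendsto_const) (auto simp: x_log_x_growth_def)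
    then show "((\<lambda>x. type_sum r x / (K * x * ln x)) \<longlongrightarrow> 1) at_top"
      using K(1) by (simp add: mult_ac)
  qed
  then show ?thesis by (auto simp: sum_num_unitary_factors_eq_type_sum)
qed

end
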